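(* Suppose the following statement (Gvözdjak's Conjecture) holds: for every positive integer $n$ and all integers $x\neq y$ with $0\le x,y\le n-1$ such that $|x-y|\equiv\lfloor n/2\rfloor \pmod 2$, $|x-y|\le n/2$ and $(n-1)/2\le x+y\le (3n-3)/2$, there is a graceful permutation of length $n$ with first element $x$ and last element $y$. Then for every positive integer $\ell$ and every $S\subseteq D_{8\ell+2}\setminus\{e\}$ with $|S|=8\ell$, the group $D_{8\ell+2}$ has an $S$-sequencing.
   Context: $D_{2m}=\langle u,v : u^m=e=v^2,\ vu=u^{m-1}v\rangle$ is the dihedral group of order $2m$. A graceful permutation of length $n$ is an arrangement $(a_1,\dots,a_n)$ of $\{0,1,\dots,n-1\}$ whose absolute differences $|a_{i+1}-a_i|$ ($1\le i\le n-1$) are exactly $\{1,\dots,n-1\}$. For $S\subseteq G\setminus\{e\}$ with $|S|=k$, an $S$-sequencing of $G$ is an ordering $(g_1,\dots,g_k)$ of the elements of $S$ such that the partial products $h_0=e$, $h_i=g_1\cdots g_i$ are pairwise distinct. *)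

theory Defs
  imports "HOL-Algebra.Group"
begin

text \<open>The dihedral group D_{2m} = <u,v : u^m = e = v^2, vu = u^{m-1} v>, concretely:
  the pair (i, a) with i < m stands for u^i v^a (a = True meaning v^1).
  (u^i v^a)(u^j v^b) = u^(i + (-1)^a j) v^(a+b).\<close>
definition dihedral_group :: "nat \<Rightarrow> (nat \<times> bool) monoid" where
  "dihedral_group m =
     \<lparr> carrier = {0..<m} \<times> UNIV,
       mult = (\<lambda>(i, a) (j, b). ((if a then i + (m - j) else i + j) mod m, a \<noteq> b)),
       one = (0, False) \<rparr>"

definition graceful_perm :: "nat \<Rightarrow> nat list \<Rightarrow> bool" where
  "graceful_perm n as \<longleftrightarrow>
     length as = n \<and> distinct as \<and> set as = {0..<n} \<and>
     (\<lambda>i. nat \<bar>int (as ! (i+1)) - int (as ! i)\<bar>) ` {0..<n-1} = {1..<n}"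

definition gvozdjak_conjecture :: bool where
  "gvozdjak_conjecture \<longleftrightarrow>
     (\<forall>n::nat. \<forall>x y::int. n \<ge> 1 \<and> x \<noteq> y \<and> 0 \<le> x \<and> x \<le> int n - 1 \<and> 0 \<le> y \<and> y \<le> int n - 1
        \<and> \<bar>x - y\<bar> mod 2 = int (n div 2) mod 2
        \<and> 2 * \<bar>x - y\<bar> \<le> int n
        \<and> int n - 1 \<le> 2 * (x + y) \<and> 2 * (x + y) \<le> 3 * int n - 3
        \<longrightarrow> (\<exists>as. graceful_perm n as \<and> int (hd as) = x \<and> int (last as) = y))"

definition partial_prod :: "('a, 'b) monoid_scheme \<Rightarrow> 'a list \<Rightarrow> nat \<Rightarrow> 'a" where
  "partial_prod G gs i = foldr (\<lambda>g acc. g \<otimes>\<^bsub>G\<^esub> acc) (take i gs) \<one>\<^bsub>G\<^esub>"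

definition S_sequencing :: "('a, 'b) monoid_scheme \<Rightarrow> 'a set \<Rightarrow> 'a list \<Rightarrow> bool" where
  "S_sequencing G S gs \<longleftrightarrow>
     distinct gs \<and> set gs = S \<and> inj_on (partial_prod G gs) {0..length gs}"

definition has_S_sequencing :: "('a, 'b) monoid_scheme \<Rightarrow> 'a set \<Rightarrow> bool" where
  "has_S_sequencing G S \<longleftrightarrow> (\<exists>gs. S_sequencing G S gs)"

end

theory Submission
  imports Defs
begin

text \<open>Write \<open>m = 4 l + 1\<close> and \<open>N = 2 l\<close>.  Since \<open>S\<close> omits only one nonidentity element \<open>g\<close>, an
  \<open>S\<close>-sequencing is a walk through all but one element of the group whose steps \<open>u\<^sup>-\<^sup>1 v\<close> cover
  everything except \<open>g\<close>.  Steps inside a coset of the rotations are rotations, with opposite signs in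
  the two cosets, and steps between the cosets are reflections.  Zigzags between the cosets produce
  runs of consecutive reflections, and a graceful permutation of length \<open>n\<close> placed once in each coset
  produces the rotations \<open>u^d\<close>, \<open>0 < \<bar>d\<bar> < n\<close>.

  If \<open>g\<close> is a reflection, an automorphism makes it any prescribed one, and blocks of length \<open>N + 1\<close> serve.
  If \<open>g = u^k\<close>, doubling the exponents (an automorphism, as \<open>m\<close> is odd) brings \<open>k\<close> into
  \<open>m \<le> 3 k < 3 m / 2\<close>; then blocks of length \<open>k\<close> are used, the rotations beyond \<open>k\<close> come from two
  explicit rows, and one of \<open>u^k\<close>, \<open>u^-k\<close> from an extra last step.  The ends of the blocks are what
  Gvozdjak's conjecture lets one choose.\<close>

section \<open>Tours\<close>

text \<open>The pair \<open>(x, a)\<close> stands for \<open>u^x v^a\<close>; exponents are integers, reduced only in \<open>dcong\<close>.\<close>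

definition dih_mult :: "int \<times> bool \<Rightarrow> int \<times> bool \<Rightarrow> int \<times> bool" where
  "dih_mult u v = ((if snd u then fst u - fst v else fst u + fst v), snd u \<noteq> snd v)"

definition dif :: "int \<times> bool \<Rightarrow> int \<times> bool \<Rightarrow> int \<times> bool" where
  "dif u v = ((if snd u then fst u - fst v else fst v - fst u), snd u \<noteq> snd v)"

fun steps :: "(int \<times> bool) list \<Rightarrow> (int \<times> bool) list" where
  "steps (u # v # vs) = dif u v # steps (v # vs)"
| "steps _ = []"

definition dcong :: "int \<Rightarrow> int \<times> bool \<Rightarrow> int \<times> bool \<Rightarrow> bool" where
  "dcong m u v \<longleftrightarrow> snd u = snd v \<and> fst u mod m = fst v mod m"

text \<open>Only covering is required: by counting, the list has no repetitions modulo \<open>m\<close> and neither do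
  its steps, and \<open>g\<close> is not a step.\<close>

definition tour :: "int \<Rightarrow> int \<times> bool \<Rightarrow> bool" where
  "tour m g \<longleftrightarrow> (\<exists>ws v. int (length ws) = 2 * m - 1
     \<and> (\<forall>u. \<not> dcong m u v \<longrightarrow> (\<exists>w\<in>set ws. dcong m w u))
     \<and> (\<forall>d. \<not> dcong m d (0, False) \<longrightarrow> \<not> dcong m d g \<longrightarrow> (\<exists>e\<in>set (steps ws). dcong m e d)))"

lemma dih_mult_assoc: "dih_mult (dih_mult u v) w = dih_mult u (dih_mult v w)"
  by (auto simp: dih_mult_def)

lemma dih_mult_dif [simp]: "dih_mult u (dif u v) = v"
  by (cases v) (auto simp: dih_mult_def dif_def)

lemma dih_mult_unit [simp]: "dih_mult u (0, False) = u"
  by (cases u) (auto simp: dih_mult_def)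

lemma length_steps [simp]: "length (steps ws) = length ws - 1"
  by (induction ws rule: steps.induct) auto

text \<open>Telescoping: each step is the inverse of one vertex times the next, so an initial
  product of steps carries the start to the vertex reached.\<close>

lemma prod_steps:
  "i < length ws \<Longrightarrow> dih_mult (hd ws) (foldr dih_mult (take i (steps ws)) (0, False)) = ws ! i"
proof (induction ws arbitrary: i rule: steps.induct)
  case (1 u v vs)
  then show ?case
    by (cases i) (simp_all flip: dih_mult_assoc)
qed auto

section \<open>Reduction of integer exponents modulo m\<close>

definition dih_res :: "nat \<Rightarrow> int \<times> bool \<Rightarrow> nat \<times> bool" where
  "dih_res m u = (nat (fst u mod int m), snd u)"

lemma dih_res_eq_iff: "m > 0 \<Longrightarrow> dih_res m u = dih_res m v \<longleftrightarrow> dcong (int m) u v"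
  by (auto simp: dih_res_def dcong_def eq_nat_nat_iff)

lemma dih_res_mult:
  assumes "m > 0"
  shows "dih_res m (dih_mult u v) = dih_res m u \<otimes>\<^bsub>dihedral_group m\<^esub> dih_res m v"
proof -
  obtain x a y b where uv: "u = (x, a)" "v = (y, b)" by (cases u, cases v) auto
  \<comment> \<open>This bound keeps the truncated subtraction in the multiplication of
    \<open>dihedral_group\<close> exact.\<close>
  have y: "nat (y mod int m) \<le> m" 
    using assms by (simp add: nat_le_iff less_imp_le)
  have "int ((nat (x mod int m) + (m - nat (y mod int m))) mod m) = (x - y) mod int m"
    using assms y by (simp add: zmod_int of_nat_diff) (metis mod_add_right_eq mod_diff_eq mod_add_self1 add_diff_eq
        diff_add_eq mod_add_self2)
  then have "nat ((x - y) mod int m) = (nat (x mod int m) + (m - nat (y mod int m))) mod m"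
    by (metis nat_int)
  moreover have "int ((nat (x mod int m) + nat (y mod int m)) mod m) = (x + y) mod int m"
    using assms by (simp add: zmod_int mod_simps)
  then have "nat ((x + y) mod int m) = (nat (x mod int m) + nat (y mod int m)) mod m"
    by (metis nat_int)
  ultimately show ?thesis
    by (simp add: uv dih_res_def dih_mult_def dihedral_group_def)
qed

lemma partial_prod_dih_res:
  assumes "m > 0"
  shows "partial_prod (dihedral_group m) (map (dih_res m) es) i
    = dih_res m (foldr dih_mult (take i es) (0, False))"
proof (induction es arbitrary: i)
  case Nil
  then show ?case
    by (simp add: partial_prod_def dih_res_def dihedral_group_def)
next
  case (Cons e es)
  then show ?case
    by (cases i) (simp_all add: partial_prod_def dih_res_mult[OF assms],
        simp add: dih_res_def dihedral_group_def)
qed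

lemma carrier_dihedral: "carrier (dihedral_group m) = {0..<m} \<times> UNIV"
  by (simp add: dihedral_group_def)

lemma one_dihedral: "\<one>\<^bsub>dihedral_group m\<^esub> = (0, False)"
  by (simp add: dihedral_group_def)

lemma card_carrier_dihedral: "card (carrier (dihedral_group m)) = 2 * m"
  by (simp add: carrier_dihedral card_cartesian_product)

lemma finite_carrier_dihedral: "finite (carrier (dihedral_group m))"
  by (simp add: carrier_dihedral)

lemma dih_res_of_carrier:
  "u \<in> carrier (dihedral_group m) \<Longrightarrow> dih_res m (int (fst u), snd u) = u"
  by (auto simp: dih_res_def carrier_dihedral)

lemma tour_imp_has_S_sequencing:
  assumes tour: "tour (int m) (int (fst g), snd g)" and m: "m > 0"
    and g: "g \<in> carrier (dihedral_group m)" "g \<noteq> \<one>\<^bsub>dihedral_group m\<^esub>"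
  shows "has_S_sequencing (dihedral_group m)
    (carrier (dihedral_group m) - {\<one>\<^bsub>dihedral_group m\<^esub>, g})"
proof -
  let ?C = "carrier (dihedral_group m)"
  let ?S = "?C - {\<one>\<^bsub>dihedral_group m\<^esub>, g}"
  obtain ws v where len: "int (length ws) = 2 * int m - 1"
    and cov: "\<And>u. \<not> dcong (int m) u v \<Longrightarrow> \<exists>w\<in>set ws. dcong (int m) w u"
    and dcov: "\<And>d. \<not> dcong (int m) d (0, False) \<Longrightarrow> \<not> dcong (int m) d (int (fst g), snd g)
      \<Longrightarrow> \<exists>e\<in>set (steps ws). dcong (int m) e d"
    using tour unfolding tour_def by blast
  let ?r = "dih_res m"
  have len': "length ws = 2 * m - 1" using len m by linarith
  have "?C - {?r v} \<subseteq> set (map ?r ws)"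
  proof
    fix u assume u: "u \<in> ?C - {?r v}"
    let ?u = "(int (fst u), snd u)"
    have ru: "?r ?u = u" using u dih_res_of_carrier by blast
    then have "\<not> dcong (int m) ?u v" using u dih_res_eq_iff[OF m] by (metis DiffD2 singletonI)
    then obtain w where "w \<in> set ws" "dcong (int m) w ?u" using cov by blast
    then show "u \<in> set (map ?r ws)" using ru m dih_res_eq_iff by (metis imageI list.set_map)
  qed
  then have "card (?C - {?r v}) \<le> card (set (map ?r ws))"
    by (meson List.finite_set card_mono)
  moreover have "card ?C - 1 \<le> card (?C - {?r v})"
    using finite_carrier_dihedral by (simp add: card_Diff_singleton_if)
  \<comment> \<open>At least \<open>2 * m - 1\<close> residues are met by a list of exactly that
    length, so none is met twice.\<close>
  ultimately have "length (map ?r ws) \<le> card (set (map ?r ws))"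
    by (simp add: card_carrier_dihedral len')
  then have dist: "distinct (map ?r ws)"
    by (metis card_distinct card_length le_antisym)
  let ?gs = "map ?r (steps ws)"
  have sub: "?S \<subseteq> set ?gs"
  proof
    fix u assume u: "u \<in> ?S"
    let ?u = "(int (fst u), snd u)"
    have ru: "?r ?u = u" using u dih_res_of_carrier by blast
    have "?r (0, False) = \<one>\<^bsub>dihedral_group m\<^esub>" by (simp add: dih_res_def one_dihedral)
    then have "\<not> dcong (int m) ?u (0, False)" using u ru dih_res_eq_iff[OF m] by (metis DiffD2 insertI1)
    moreover have "\<not> dcong (int m) ?u (int (fst g), snd g)"
      using u ru dih_res_eq_iff[OF m] dih_res_of_carrier[OF g(1)] by (metis DiffD2 insertI1 insertI2)
    ultimately obtain w where "w \<in> set (steps ws)" "dcong (int m) w ?u" using dcov by blast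
    then show "u \<in> set ?gs" using ru m dih_res_eq_iff by (metis imageI list.set_map)
  qed
  have one: "\<one>\<^bsub>dihedral_group m\<^esub> \<in> ?C" using m by (simp add: one_dihedral carrier_dihedral)
  have "card {\<one>\<^bsub>dihedral_group m\<^esub>, g} = 2" using g(2) by simp
  moreover have "{\<one>\<^bsub>dihedral_group m\<^esub>, g} \<subseteq> ?C" using one g(1) by simp
  ultimately have cardS: "card ?S = 2 * m - 2"
    by (metis card_Diff_subset card_carrier_dihedral finite.emptyI finite_insert)
  have lgs: "length ?gs = 2 * m - 2" by (simp add: len')
  have "card (set ?gs) \<le> card ?S" using card_length[of ?gs] by (simp only: cardS lgs)
  then have seq: "set ?gs = ?S" using sub by (metis List.finite_set card_seteq)
  have dgs: "distinct ?gs" using seq cardS lgs by (metis card_distinct)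
  have "inj_on (partial_prod (dihedral_group m) ?gs) {0..length ?gs}"
  proof (rule inj_onI)
    fix i j assume ij: "i \<in> {0..length ?gs}" "j \<in> {0..length ?gs}"
      and eq: "partial_prod (dihedral_group m) ?gs i = partial_prod (dihedral_group m) ?gs j"
    let ?P = "\<lambda>i. foldr dih_mult (take i (steps ws)) (0, False)"
    have lt: "i < length ws" "j < length ws" using ij lgs len' m by auto
    \<comment> \<open>Left multiplication by the start of the walk turns partial products into
      vertices, already known to be distinct.\<close>
    have "?r (dih_mult (hd ws) (?P i)) = ?r (dih_mult (hd ws) (?P j))"
      using eq m by (simp only: dih_res_mult partial_prod_dih_res)
    then have "map ?r ws ! i = map ?r ws ! j" by (simp only: prod_steps[OF lt(1)] prod_steps[OF lt(2)] nth_map lt)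
    then show "i = j" using dist lt by (simp only: nth_eq_iff_index_eq length_map)
  qed
  then show ?thesis
    unfolding has_S_sequencing_def S_sequencing_def using seq dgs by blast
qed

section \<open>Automorphisms acting on tours\<close>

lemma tour_dcong: "tour m g \<Longrightarrow> dcong m g h \<Longrightarrow> tour m h"
  unfolding tour_def dcong_def by auto

lemma steps_map:
  assumes "\<And>u v. dif (f u) (f v) = h (dif u v)"
  shows "steps (map f ws) = map h (steps ws)"
  by (induction ws rule: steps.induct) (auto simp: assms)

lemma mod_mult_inverse:
  fixes t :: int
  assumes "t * t' mod m = 1 mod m"
  shows "x mod m = (t' * y) mod m \<longleftrightarrow> (t * x) mod m = y mod m"
proof
  assume "x mod m = (t' * y) mod m"
  then have "(t * x) mod m = (t * t' * y) mod m" by (metis mod_mult_right_eq mult.assoc)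
  then show "(t * x) mod m = y mod m" using assms by (metis mod_mult_left_eq mult_1)
next
  assume "(t * x) mod m = y mod m"
  then have "(t' * y) mod m = (t * t' * x) mod m" by (metis mod_mult_right_eq mult.assoc mult.commute)
  then show "x mod m = (t' * y) mod m" using assms by (metis mod_mult_left_eq mult_1)
qed

text \<open>For \<open>t\<close> invertible, multiplying exponents by \<open>t\<close> is an
  automorphism and so maps steps to steps; scaling by \<open>t'\<close> pulls back the vertex or
  step to be covered.\<close>

lemma tour_scale:
  assumes "tour m (c, False)" "t * t' mod m = 1 mod m"
  shows "tour m (t * c, False)"
proof -
  obtain ws v where len: "int (length ws) = 2 * m - 1"
    and cov: "\<And>u. \<not> dcong m u v \<Longrightarrow> \<exists>w\<in>set ws. dcong m w u"
    and dcov: "\<And>d. \<not> dcong m d (0, False) \<Longrightarrow> \<not> dcong m d (c, False)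
      \<Longrightarrow> \<exists>e\<in>set (steps ws). dcong m e d"
    using assms(1) unfolding tour_def by blast
  let ?f = "\<lambda>u :: int \<times> bool. (t * fst u, snd u)"
  let ?f' = "\<lambda>u :: int \<times> bool. (t' * fst u, snd u)"
  have conv: "dcong m u (?f' w) \<longleftrightarrow> dcong m (?f u) w" for u w
    using mod_mult_inverse[OF assms(2)] by (simp add: dcong_def)
  have steps: "steps (map ?f ws) = map ?f (steps ws)"
    by (rule steps_map) (auto simp: dif_def algebra_simps)
  have sym: "dcong m u w \<longleftrightarrow> dcong m w u" for u w by (auto simp: dcong_def)
  have 1: "\<exists>w\<in>set (map ?f ws). dcong m w u" if "\<not> dcong m u (?f v)" for u
  proof -
    have "\<not> dcong m (?f' u) v" using that conv sym by metis
    then show ?thesis using cov conv by fastforce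
  qed
  have 2: "\<exists>e\<in>set (steps (map ?f ws)). dcong m e d"
    if "\<not> dcong m d (0, False)" "\<not> dcong m d (t * c, False)" for d
  proof -
    have "\<not> dcong m (?f' d) (0, False)" using that(1) conv[of "(0, False)" d] sym by simp
    moreover have "\<not> dcong m (?f' d) (c, False)" using that(2) conv[of "(c, False)" d] sym by simp
    ultimately show ?thesis unfolding steps using dcov conv by fastforce
  qed
  show ?thesis unfolding tour_def
    by (rule exI[of _ "map ?f ws"], rule exI[of _ "?f v"]) (use len 1 2 in auto)
qed

text \<open>Fixing \<open>u\<close> and sending \<open>v\<close> to \<open>u^e v\<close> is an
  automorphism. As \<open>e\<close> is arbitrary, one missing reflection settles all of
  them.\<close>

lemma tour_shift:
  assumes "tour m (c, True)"
  shows "tour m (c + e, True)"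
proof -
  obtain ws v where len: "int (length ws) = 2 * m - 1"
    and cov: "\<And>u. \<not> dcong m u v \<Longrightarrow> \<exists>w\<in>set ws. dcong m w u"
    and dcov: "\<And>d. \<not> dcong m d (0, False) \<Longrightarrow> \<not> dcong m d (c, True)
      \<Longrightarrow> \<exists>e\<in>set (steps ws). dcong m e d"
    using assms(1) unfolding tour_def by blast
  define f where "f u = (if snd u then fst u + e else fst u, snd u)" for u :: "int \<times> bool"
  define f' where "f' u = (if snd u then fst u - e else fst u, snd u)" for u :: "int \<times> bool"
  have conv: "dcong m u (f' w) \<longleftrightarrow> dcong m (f u) w" for u w
    by (auto simp: dcong_def f_def f'_def mod_eq_dvd_iff algebra_simps)
  have steps: "steps (map f ws) = map f (steps ws)"
    by (rule steps_map) (auto simp: dif_def f_def algebra_simps)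
  have sym: "dcong m u w \<longleftrightarrow> dcong m w u" for u w by (auto simp: dcong_def)
  have 1: "\<exists>w\<in>set (map f ws). dcong m w u" if "\<not> dcong m u (f v)" for u
  proof -
    have "\<not> dcong m (f' u) v" using that conv sym by metis
    then obtain w where "w \<in> set ws" "dcong m w (f' u)" using cov by blast
    then show ?thesis unfolding conv by (metis imageI list.set_map)
  qed
  have 2: "\<exists>e\<in>set (steps (map f ws)). dcong m e d"
    if "\<not> dcong m d (0, False)" "\<not> dcong m d (c + e, True)" for d
  proof -
    have "\<not> dcong m (f' d) (0, False)" using that(1) by (auto simp: dcong_def f'_def split: if_splits)
    moreover have "\<not> dcong m (f' d) (c, True)" using that(2) conv[of "(c, True)" d] sym by (simp add: f_def)
    ultimately obtain w where "w \<in> set (steps ws)" "dcong m w (f' d)" using dcov by blast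
    then show ?thesis unfolding steps conv by (metis imageI list.set_map)
  qed
  show ?thesis unfolding tour_def
    by (rule exI[of _ "map f ws"], rule exI[of _ "f v"]) (use len 1 2 in auto)
qed

section \<open>Trails\<close>

text \<open>\<open>V\<close> and \<open>D\<close> are only lower bounds, so concatenation needs no
  disjointness; the exact length \<open>n\<close> supplies the counting later.\<close>

definition trail :: "int \<times> bool \<Rightarrow> int \<times> bool \<Rightarrow> (int \<times> bool) set \<Rightarrow> (int \<times> bool) set \<Rightarrow> int \<Rightarrow> bool" where
  "trail u v V D n \<longleftrightarrow> (\<exists>ws. ws \<noteq> [] \<and> hd ws = u \<and> last ws = v \<and> int (length ws) = n
     \<and> V \<subseteq> set ws \<and> D \<subseteq> set (steps ws))"

lemma trail_single: "trail u u {u} {} 1"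
  unfolding trail_def by (rule exI[of _ "[u]"]) simp

lemma steps_append:
  "us \<noteq> [] \<Longrightarrow> vs \<noteq> [] \<Longrightarrow> steps (us @ vs) = steps us @ dif (last us) (hd vs) # steps vs"
proof (induction us rule: steps.induct)
  case ("2_2" u)
  then show ?case by (cases vs) auto
qed auto

lemma trail_append:
  assumes "trail u v V D n" "trail u' v' V' D' n'"
  shows "trail u v' (V \<union> V') (insert (dif v u') (D \<union> D')) (n + n')"
proof -
  obtain ws where ws: "ws \<noteq> []" "hd ws = u" "last ws = v" "int (length ws) = n"
    "V \<subseteq> set ws" "D \<subseteq> set (steps ws)" using assms(1) unfolding trail_def by blast
  obtain ws' where ws': "ws' \<noteq> []" "hd ws' = u'" "last ws' = v'" "int (length ws') = n'"
    "V' \<subseteq> set ws'" "D' \<subseteq> set (steps ws')" using assms(2) unfolding trail_def by blast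
  show ?thesis unfolding trail_def
    by (rule exI[of _ "ws @ ws'"]) (use ws ws' in \<open>auto simp: steps_append\<close>)
qed

text \<open>The zigzag runs down the reflections \<open>q1, q1 - 1, \<dots>, q2\<close> and up the rotations
  \<open>p1, p1 + 1, \<dots>, p2\<close>.  The flags \<open>sq\<close> and \<open>rq\<close> tell whether it starts and ends with a reflection.\<close>

lemma zigzag:
  assumes "q1 - q2 - (p2 - p1) = of_bool sq + of_bool rq - 1" "q2 \<le> q1 + 1" "p1 \<le> p2 + 1"
    and "q2 \<le> q1 \<or> p1 \<le> p2"
  shows "trail (if sq then (q1, True) else (p1, False)) (if rq then (q2, True) else (p2, False))
    ({q2..q1} \<times> {True} \<union> {p1..p2} \<times> {False}) ({q2 - p2..q1 - p1} \<times> {True})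
    (q1 - q2 + 1 + (p2 - p1 + 1))"
  using assms
proof (induction "nat (q1 - q2 + (p2 - p1) + 2)" arbitrary: q1 p1 sq rule: less_induct)
  case less
  show ?case
  proof (cases sq)
    case sq: True
    then have q: "q2 \<le> q1" using less.prems by (cases rq) auto
    show ?thesis
    proof (cases "p1 \<le> p2 \<or> q2 < q1")
      case True
      \<comment> \<open>Removing the first vertex flips \<open>sq\<close> and takes away the top
        reflection \<open>q1 - p1\<close>; the remaining steps stay consecutive.\<close>
      have "trail (if False then (q1 - 1, True) else (p1, False)) (if rq then (q2, True) else (p2, False))
        ({q2..q1 - 1} \<times> {True} \<union> {p1..p2} \<times> {False}) ({q2 - p2..q1 - 1 - p1} \<times> {True})
        (q1 - 1 - q2 + 1 + (p2 - p1 + 1))"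
        by (rule less.hyps) (use less.prems sq q True in \<open>auto split: if_splits\<close>)
      from trail_append[OF trail_single this, of "(q1, True)"]
      have "trail (q1, True) (if rq then (q2, True) else (p2, False))
        ({(q1, True)} \<union> ({q2..q1 - 1} \<times> {True} \<union> {p1..p2} \<times> {False}))
        (insert (q1 - p1, True) ({} \<union> {q2 - p2..q1 - 1 - p1} \<times> {True}))
        (1 + (q1 - 1 - q2 + 1 + (p2 - p1 + 1)))"
        by (simp add: dif_def)
      moreover have "{(q1, True)} \<union> ({q2..q1 - 1} \<times> {True} \<union> {p1..p2} \<times> {False})
        = {q2..q1} \<times> {True} \<union> {p1..p2} \<times> {False}" using q by auto
      moreover have "insert (q1 - p1, True) ({} \<union> {q2 - p2..q1 - 1 - p1} \<times> {True})
        = {q2 - p2..q1 - p1} \<times> {True}" using less.prems q True by auto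
      ultimately show ?thesis using sq by (simp add: algebra_simps)
    next
      case False
      then have "rq" "q1 = q2" "p2 = p1 - 1" using less.prems sq q by (cases rq; auto)+
      then show ?thesis using sq trail_single[of "(q2, True)"] by simp
    qed
  next
    case sq: False
    then have p: "p1 \<le> p2" using less.prems by (cases rq) auto
    show ?thesis
    proof (cases "p1 < p2 \<or> q2 \<le> q1")
      case True
      have "trail (if True then (q1, True) else (p1 + 1, False)) (if rq then (q2, True) else (p2, False))
        ({q2..q1} \<times> {True} \<union> {p1 + 1..p2} \<times> {False}) ({q2 - p2..q1 - (p1 + 1)} \<times> {True})
        (q1 - q2 + 1 + (p2 - (p1 + 1) + 1))"
        by (rule less.hyps) (use less.prems sq p True in \<open>auto split: if_splits\<close>)
      from trail_append[OF trail_single this, of "(p1, False)"]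
      have "trail (p1, False) (if rq then (q2, True) else (p2, False))
        ({(p1, False)} \<union> ({q2..q1} \<times> {True} \<union> {p1 + 1..p2} \<times> {False}))
        (insert (q1 - p1, True) ({} \<union> {q2 - p2..q1 - (p1 + 1)} \<times> {True}))
        (1 + (q1 - q2 + 1 + (p2 - (p1 + 1) + 1)))"
        by (simp add: dif_def)
      moreover have "{(p1, False)} \<union> ({q2..q1} \<times> {True} \<union> {p1 + 1..p2} \<times> {False})
        = {q2..q1} \<times> {True} \<union> {p1..p2} \<times> {False}" using p by auto
      moreover have "insert (q1 - p1, True) ({} \<union> {q2 - p2..q1 - (p1 + 1)} \<times> {True})
        = {q2 - p2..q1 - p1} \<times> {True}" using less.prems p True sq by (auto split: if_splits)
      ultimately show ?thesis using sq by (simp add: algebra_simps)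
    next
      case False
      then have "\<not> rq" "p1 = p2" "q2 = q1 + 1" using less.prems sq p by (cases rq; auto)+
      then show ?thesis using sq trail_single[of "(p2, False)"] by simp
    qed
  qed
qed

text \<open>The two letters give the cosets of the first and last vertex, \<open>q\<close> for
  reflections and \<open>p\<close> for rotations. Positional instances list \<open>q1\<close>,
  \<open>q2\<close>, \<open>p2\<close>, \<open>p1\<close>.\<close>

lemmas zigzag_qp = zigzag[where sq = True and rq = False, simplified]
lemmas zigzag_qq = zigzag[where sq = True and rq = True, simplified]
lemmas zigzag_pq = zigzag[where sq = False and rq = True, simplified]
lemmas zigzag_pp = zigzag[where sq = False and rq = False, simplified]

section \<open>Gaps of integer rows, copied into either coset\<close>

fun gaps :: "int list \<Rightarrow> int list" where
  "gaps (x # y # zs) = (y - x) # gaps (y # zs)"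
| "gaps _ = []"

lemma gaps_append:
  "us \<noteq> [] \<Longrightarrow> vs \<noteq> [] \<Longrightarrow> gaps (us @ vs) = gaps us @ (hd vs - last us) # gaps vs"
proof (induction us rule: gaps.induct)
  case ("2_2" u)
  then show ?case by (cases vs) auto
qed auto

lemma gaps_rev: "set (gaps (rev xs)) = uminus ` set (gaps xs)"
proof (induction xs rule: gaps.induct)
  case (1 x y zs)
  have "gaps (rev (x # y # zs)) = gaps (rev (y # zs)) @ [x - y]"
    using gaps_append[of "rev (y # zs)" "[x]"] by simp
  then show ?case using 1 by auto
qed auto

lemma steps_rot: "steps (map (\<lambda>z. (c + z, False)) xs) = map (\<lambda>d. (d, False)) (gaps xs)"
  by (induction xs rule: gaps.induct) (auto simp: dif_def)

lemma steps_refl: "steps (map (\<lambda>z. (c + z, True)) xs) = map (\<lambda>d. (- d, False)) (gaps xs)"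
  by (induction xs rule: gaps.induct) (auto simp: dif_def)

lemma steps_refl_minus: "steps (map (\<lambda>z. (c - z, True)) xs) = map (\<lambda>d. (d, False)) (gaps xs)"
  by (induction xs rule: gaps.induct) (auto simp: dif_def)

lemma steps_rot_minus: "steps (map (\<lambda>z. (c - z, False)) xs) = map (\<lambda>d. (- d, False)) (gaps xs)"
  by (induction xs rule: gaps.induct) (auto simp: dif_def)

lemma trail_rot:
  "xs \<noteq> [] \<Longrightarrow> trail (c + hd xs, False) (c + last xs, False) ((\<lambda>z. (c + z, False)) ` set xs)
     ((\<lambda>d. (d, False)) ` set (gaps xs)) (int (length xs))"
  unfolding trail_def
  by (rule exI[of _ "map (\<lambda>z. (c + z, False)) xs"]) (auto simp: steps_rot hd_map last_map)

lemma trail_refl: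
  "xs \<noteq> [] \<Longrightarrow> trail (c + hd xs, True) (c + last xs, True) ((\<lambda>z. (c + z, True)) ` set xs)
     ((\<lambda>d. (- d, False)) ` set (gaps xs)) (int (length xs))"
  unfolding trail_def
  by (rule exI[of _ "map (\<lambda>z. (c + z, True)) xs"]) (auto simp: steps_refl hd_map last_map)

text \<open>Reversing a row and complementing it each negate the gaps, so the rotations obtained are
  those of \<open>trail_refl\<close> while the ends change.\<close>

lemma trail_refl_rev:
  "xs \<noteq> [] \<Longrightarrow> trail (c - last xs, True) (c - hd xs, True) ((\<lambda>z. (c - z, True)) ` set xs)
     ((\<lambda>d. (- d, False)) ` set (gaps xs)) (int (length xs))"
  unfolding trail_def
  by (rule exI[of _ "map (\<lambda>z. (c - z, True)) (rev xs)"])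
    (auto simp: steps_refl_minus hd_map last_map hd_rev last_rev gaps_rev image_image)

lemma trail_rot_rev:
  "xs \<noteq> [] \<Longrightarrow> trail (c - last xs, False) (c - hd xs, False) ((\<lambda>z. (c - z, False)) ` set xs)
     ((\<lambda>d. (d, False)) ` set (gaps xs)) (int (length xs))"
  unfolding trail_def
  by (rule exI[of _ "map (\<lambda>z. (c - z, False)) (rev xs)"])
    (auto simp: steps_rot_minus hd_map last_map hd_rev last_rev gaps_rev image_image)

lemma gaps_nth: "i + 1 < length xs \<Longrightarrow> xs ! (i + 1) - xs ! i \<in> set (gaps xs)"
proof (induction xs arbitrary: i rule: gaps.induct)
  case (1 x y zs)
  then show ?case by (cases i) auto
qed auto

section \<open>Gvozdjak's conjecture and graceful blocks\<close>

lemma gvozdjak_gaps: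
  assumes gvozdjak_conjecture
    and "1 \<le> n" "x \<noteq> y" "0 \<le> x" "x \<le> n - 1" "0 \<le> y" "y \<le> n - 1"
    and "even (x - y - n div 2)" "2 * \<bar>x - y\<bar> \<le> n" "n - 1 \<le> 2 * (x + y)" "2 * (x + y) \<le> 3 * n - 3"
  obtains xs :: "int list" where "xs \<noteq> []" "int (length xs) = n" "set xs = {0..n - 1}" "hd xs = x" "last xs = y"
    "\<And>d. 1 \<le> d \<Longrightarrow> d \<le> n - 1 \<Longrightarrow> d \<in> set (gaps xs) \<or> - d \<in> set (gaps xs)"
proof -
  obtain k where k: "n = int k" using assms(2) by (metis nonneg_int_cases order_trans zero_le_one)
  have "\<bar>x - y\<bar> mod 2 = int (k div 2) mod 2"
  proof -
    have "\<bar>x - y\<bar> mod 2 = (x - y) mod 2" by presburger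
    also have "\<dots> = (n div 2) mod 2" using assms(8) by presburger
    finally show ?thesis by (simp add: k zdiv_int)
  qed
  then have "\<exists>as. graceful_perm k as \<and> int (hd as) = x \<and> int (last as) = y"
    using assms unfolding gvozdjak_conjecture_def k by auto
  then obtain as where as: "graceful_perm k as" "int (hd as) = x" "int (last as) = y" by blast
  have len: "length as = k" and set: "set as = {0..<k}"
    and dif: "(\<lambda>i. nat \<bar>int (as ! (i+1)) - int (as ! i)\<bar>) ` {0..<k-1} = {1..<k}"
    using as(1) unfolding graceful_perm_def by auto
  have ne: "as \<noteq> []" using len k assms(2) by auto
  show thesis
  proof (rule that[of "map int as"])
    show "set (map int as) = {0..n - 1}"
      using k by (auto simp: set image_int_atLeastLessThan)
    fix d assume d: "1 \<le> d" "d \<le> n - 1"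
    then have "nat d \<in> (\<lambda>i. nat \<bar>int (as ! (i+1)) - int (as ! i)\<bar>) ` {0..<k-1}"
      unfolding dif using k by auto
    then obtain i where i: "i < k - 1" "nat d = nat \<bar>int (as ! (i+1)) - int (as ! i)\<bar>" by auto
    have "map int as ! (i + 1) - map int as ! i \<in> set (gaps (map int as))"
      by (rule gaps_nth) (use i len in auto)
    then have "int (as ! (i+1)) - int (as ! i) \<in> set (gaps (map int as))" using i len by simp
    moreover have "int (as ! (i+1)) - int (as ! i) = d \<or> int (as ! (i+1)) - int (as ! i) = - d"
      using i(2) d by linarith
    ultimately show "d \<in> set (gaps (map int as)) \<or> - d \<in> set (gaps (map int as))" by auto
  qed (use as len ne k in \<open>auto simp: hd_map last_map\<close>)
qed

definition gvoz_ends :: "int \<Rightarrow> int \<Rightarrow> int \<Rightarrow> bool" where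
  "gvoz_ends n x y \<longleftrightarrow> 1 \<le> n \<and> x \<noteq> y \<and> 0 \<le> x \<and> x \<le> n - 1 \<and> 0 \<le> y \<and> y \<le> n - 1
    \<and> even (x - y - n div 2) \<and> 2 * \<bar>x - y\<bar> \<le> n \<and> n - 1 \<le> 2 * (x + y) \<and> 2 * (x + y) \<le> 3 * n - 3"

lemma trail_weaken:
  assumes "trail u v V D n" "V' \<subseteq> V" "D' \<subseteq> D"
  shows "trail u v V' D' n"
proof -
  obtain ws where "ws \<noteq> []" "hd ws = u" "last ws = v" "int (length ws) = n"
    "V \<subseteq> set ws" "D \<subseteq> set (steps ws)" using assms(1) unfolding trail_def by blast
  then show ?thesis unfolding trail_def
    by (intro exI[of _ ws]) (use assms(2,3) in auto)
qed

lemma image_shift_Pair: "(\<lambda>z. (c + z, b)) ` {i..j} = {c + i..c + j} \<times> {b}" for c i j :: int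
proof -
  have "(c + z, b) \<in> {c + i..c + j} \<times> {b}" if "z \<in> {i..j}" for z using that by auto
  moreover have "(z, b) \<in> (\<lambda>z. (c + z, b)) ` {i..j}" if "z \<in> {c + i..c + j}" for z
    by (rule image_eqI[of _ _ "z - c"]) (use that in auto)
  ultimately show ?thesis by auto
qed

lemma image_reflect_Pair: "(\<lambda>z. (c - z, b)) ` {i..j} = {c - j..c - i} \<times> {b}" for c i j :: int
proof -
  have "(c - z, b) \<in> {c - j..c - i} \<times> {b}" if "z \<in> {i..j}" for z using that by auto
  moreover have "(z, b) \<in> (\<lambda>z. (c - z, b)) ` {i..j}" if "z \<in> {c - j..c - i}" for z
    by (rule image_eqI[of _ _ "c - z"]) (use that in auto)
  ultimately show ?thesis by auto
qed

text \<open>A graceful block on \<open>{s..s + n - 1}\<close> in the rotations and a translate or reversed complement of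
  it on \<open>{t..t + n - 1}\<close> in the reflections together contribute each \<open>u^d\<close> with \<open>0 < \<bar>d\<bar> < n\<close>, because
  the two copies traverse their steps with opposite signs.\<close>

lemma gaps_both_signs:
  fixes n :: int
  assumes "\<And>d. 1 \<le> d \<Longrightarrow> d \<le> n - 1 \<Longrightarrow> d \<in> E \<or> - d \<in> E"
  shows "({1 - n..n - 1} - {0}) \<times> {False} \<subseteq> (\<lambda>d. (d, False)) ` E \<union> (\<lambda>d. (- d, False)) ` E"
proof -
  have "d \<in> E \<or> - d \<in> E" if "d \<noteq> 0" "1 - n \<le> d" "d \<le> n - 1" for d
    using assms[of d] assms[of "- d"] that by (cases "d > 0") auto
  then show ?thesis by (auto simp: image_iff) (metis add.inverse_inverse)
qed

text \<open>Four versions, to choose entry, exit and junction: apart from \<open>s\<close>,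
  \<open>t\<close> and \<open>n\<close>, the junction reflection depends on \<open>x - y\<close> for
  a translated copy and on \<open>y\<close> alone for a reversed complement.\<close>

lemma graceful_blocks:
  assumes gvozdjak_conjecture "gvoz_ends n x y"
  shows block_rot_refl: "trail (s + x, False) (t + y, True)
      ({s..s + n - 1} \<times> {False} \<union> {t..t + n - 1} \<times> {True})
      (insert (t + x - (s + y), True) (({1 - n..n - 1} - {0}) \<times> {False})) (2 * n)"
    and block_rot_refl_rev: "trail (s + x, False) (t + (n - 1 - x), True)
      ({s..s + n - 1} \<times> {False} \<union> {t..t + n - 1} \<times> {True})
      (insert (t + (n - 1 - y) - (s + y), True) (({1 - n..n - 1} - {0}) \<times> {False})) (2 * n)"
    and block_refl_rot: "trail (t + x, True) (s + y, False)
      ({s..s + n - 1} \<times> {False} \<union> {t..t + n - 1} \<times> {True})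
      (insert (t + y - (s + x), True) (({1 - n..n - 1} - {0}) \<times> {False})) (2 * n)"
    and block_refl_rot_rev: "trail (t + x, True) (s + (n - 1 - x), False)
      ({s..s + n - 1} \<times> {False} \<union> {t..t + n - 1} \<times> {True})
      (insert (t + y - (s + (n - 1 - y)), True) (({1 - n..n - 1} - {0}) \<times> {False})) (2 * n)"
proof -
  obtain xs where xs: "xs \<noteq> []" "int (length xs) = n" "set xs = {0..n - 1}" "hd xs = x" "last xs = y"
    and d: "\<And>d. 1 \<le> d \<Longrightarrow> d \<le> n - 1 \<Longrightarrow> d \<in> set (gaps xs) \<or> - d \<in> set (gaps xs)"
    using gvozdjak_gaps assms unfolding gvoz_ends_def by metis
  have flip: "(\<lambda>d. (d, False)) ` set (gaps xs) \<union> (\<lambda>d. (- d, False)) ` set (gaps xs) = 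
    (\<lambda>d. (- d, False)) ` set (gaps xs) \<union> (\<lambda>d. (d, False)) ` set (gaps xs)" by blast
  note D = gaps_both_signs[OF d]
  note rot = trail_rot[OF xs(1), of s, unfolded xs image_shift_Pair image_reflect_Pair]
  note refl = trail_refl[OF xs(1), of t, unfolded xs image_shift_Pair image_reflect_Pair]
  note refl_rev = trail_refl_rev[OF xs(1), of "t + (n - 1)", unfolded xs image_shift_Pair image_reflect_Pair]
  note rot_rev = trail_rot_rev[OF xs(1), of "s + (n - 1)", unfolded xs image_shift_Pair image_reflect_Pair]
  show "trail (s + x, False) (t + y, True)
      ({s..s + n - 1} \<times> {False} \<union> {t..t + n - 1} \<times> {True})
      (insert (t + x - (s + y), True) (({1 - n..n - 1} - {0}) \<times> {False})) (2 * n)"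
    using trail_weaken[OF trail_append[OF rot refl, folded mult_2], OF subset_refl insert_mono[OF D]]
    by (simp add: dif_def algebra_simps)
  show "trail (t + x, True) (s + y, False)
      ({s..s + n - 1} \<times> {False} \<union> {t..t + n - 1} \<times> {True})
      (insert (t + y - (s + x), True) (({1 - n..n - 1} - {0}) \<times> {False})) (2 * n)"
    using trail_weaken[OF trail_append[OF refl rot, folded mult_2], OF subset_refl insert_mono[OF D[unfolded flip]]]
    by (simp add: dif_def algebra_simps Un_commute)
  show "trail (s + x, False) (t + (n - 1 - x), True)
      ({s..s + n - 1} \<times> {False} \<union> {t..t + n - 1} \<times> {True})
      (insert (t + (n - 1 - y) - (s + y), True) (({1 - n..n - 1} - {0}) \<times> {False})) (2 * n)"
    using trail_weaken[OF trail_append[OF rot refl_rev, folded mult_2], OF subset_refl insert_mono[OF D]]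
    by (simp add: dif_def algebra_simps)
  show "trail (t + x, True) (s + (n - 1 - x), False)
      ({s..s + n - 1} \<times> {False} \<union> {t..t + n - 1} \<times> {True})
      (insert (t + y - (s + (n - 1 - y)), True) (({1 - n..n - 1} - {0}) \<times> {False})) (2 * n)"
    using trail_weaken[OF trail_append[OF refl rot_rev, folded mult_2], OF subset_refl insert_mono[OF D[unfolded flip]]]
    by (simp add: dif_def algebra_simps Un_commute)
qed

section \<open>Rows and flanks\<close>

definition row :: "int \<Rightarrow> int \<Rightarrow> int set \<Rightarrow> int set \<Rightarrow> int \<Rightarrow> bool" where
  "row r s V G n \<longleftrightarrow> (\<exists>xs. xs \<noteq> [] \<and> hd xs = r \<and> last xs = s \<and> int (length xs) = n \<and> V \<subseteq> set xs
     \<and> (\<forall>d\<in>G. d \<in> set (gaps xs) \<or> - d \<in> set (gaps xs)))"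

lemma row_single: "row r r {r} {} 1"
  unfolding row_def by (rule exI[of _ "[r]"]) simp

lemma row_snoc:
  assumes "row r s V G n"
  shows "row r t (insert t V) (insert \<bar>t - s\<bar> G) (n + 1)"
proof -
  obtain xs where xs: "xs \<noteq> []" "hd xs = r" "last xs = s" "int (length xs) = n" "V \<subseteq> set xs"
    "\<forall>d\<in>G. d \<in> set (gaps xs) \<or> - d \<in> set (gaps xs)" using assms unfolding row_def by blast
  have "set (gaps (xs @ [t])) = insert (t - s) (set (gaps xs))"
    using gaps_append[OF xs(1), of "[t]"] xs(3) by simp
  then show ?thesis unfolding row_def
    by (intro exI[of _ "xs @ [t]"]) (use xs in \<open>auto simp: abs_if\<close>)
qed

lemma row_rev:
  assumes "row r s V G n"
  shows "row s r V G n"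
proof -
  obtain xs where xs: "xs \<noteq> []" "hd xs = r" "last xs = s" "int (length xs) = n" "V \<subseteq> set xs"
    "\<forall>d\<in>G. d \<in> set (gaps xs) \<or> - d \<in> set (gaps xs)" using assms unfolding row_def by blast
  moreover have uminus_in: "d \<in> uminus ` S \<longleftrightarrow> - d \<in> S" for d :: int and S
    by (metis add.inverse_inverse imageE imageI)
  ultimately show ?thesis unfolding row_def
    by (intro exI[of _ "rev xs"]) (auto simp: hd_rev last_rev gaps_rev uminus_in)
qed

lemma row_weaken:
  assumes "row r s V G n" "V' \<subseteq> V" "G' \<subseteq> G"
  shows "row r s V' G' n"
proof -
  obtain xs where "xs \<noteq> []" "hd xs = r" "last xs = s" "int (length xs) = n" "V \<subseteq> set xs"
    "\<forall>d\<in>G. d \<in> set (gaps xs) \<or> - d \<in> set (gaps xs)" using assms(1) unfolding row_def by blast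
  then show ?thesis unfolding row_def
    by (intro exI[of _ xs]) (use assms(2,3) in auto)
qed

text \<open>Modulo \<open>2 N + 1\<close>, the steps of length \<open>N + 1, \<dots>, N + a + b - 1\<close> are the rotations \<open>u^d\<close> with
  \<open>k < \<bar>d\<bar> \<le> N\<close> for \<open>k = N + 1 - a - b\<close>, once they occur with both signs.\<close>

definition flank :: "int \<Rightarrow> int \<Rightarrow> int \<Rightarrow> int \<Rightarrow> int \<Rightarrow> bool" where
  "flank N a b r s \<longleftrightarrow> row r s ({1 - a..0} \<union> {N + 1..N + b}) {N + 1..N + a + b - 1} (a + b)"

lemma flank_rev: "flank N a b r s \<Longrightarrow> flank N a b s r"
  unfolding flank_def by (rule row_rev)

text \<open>The row ends at its leftmost vertex, so the jump to the next free vertex on the right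
  has length \<open>N + a + b\<close>, exactly the next one wanted; \<open>flank_left\<close> is the
  mirror image.\<close>

lemma flank_right:
  assumes "flank N a b r (1 - a)" "0 \<le> a" "0 \<le> b" "0 \<le> N"
  shows "flank N a (b + 1) r (N + b + 1)"
proof -
  have "row r (N + b + 1) ({1 - a..0} \<union> {N + 1..N + (b + 1)}) {N + 1..N + a + (b + 1) - 1} (a + b + 1)"
    by (rule row_weaken[OF row_snoc[OF assms(1)[unfolded flank_def], of "N + b + 1"]])
      (use assms in auto)
  then show ?thesis by (simp add: flank_def algebra_simps)
qed

lemma flank_left:
  assumes "flank N a b r (N + b)" "0 \<le> a" "0 \<le> b" "0 \<le> N"
  shows "flank N (a + 1) b r (- a)"
proof -
  have "row r (- a) ({1 - (a + 1)..0} \<union> {N + 1..N + b}) {N + 1..N + (a + 1) + b - 1} (a + b + 1)"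
    by (rule row_weaken[OF row_snoc[OF assms(1)[unfolded flank_def], of "- a"]])
      (use assms in auto)
  then show ?thesis by (simp add: flank_def algebra_simps)
qed

text \<open>The row swings outward as 0, \<open>N + 1\<close>, \<open>- 1\<close>,
  \<open>N + 2\<close> and so on, each swing one longer than the last.\<close>

lemma flank_from_left:
  assumes "0 \<le> N"
  shows "flank N (int n + 1) (int n) 0 (- int n)" "flank N (int n + 1) (int n + 1) 0 (N + int n + 1)"
proof -
  have step: "flank N (int n + 1) (int n + 1) 0 (N + int n + 1)"
    if "flank N (int n + 1) (int n) 0 (- int n)" for n
    using flank_right[of N "int n + 1" "int n" 0] that assms by simp
  have *: "flank N (int n + 1) (int n) 0 (- int n)"
  proof (induction n)
    case 0
    show ?case using row_single[of 0] by (simp add: flank_def)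
  next
    case (Suc n)
    show ?case using flank_left[of N "int n + 1" "int n + 1" 0] step[OF Suc] assms by (simp add: algebra_simps)
  qed
  then show "flank N (int n + 1) (int n) 0 (- int n)" "flank N (int n + 1) (int n + 1) 0 (N + int n + 1)"
    using step by auto
qed

lemma flank_from_right:
  assumes "0 \<le> N"
  shows "flank N (int n) (int n + 1) (N + 1) (N + int n + 1)"
proof (induction n)
  case 0
  show ?case using row_single[of "N + 1"] by (simp add: flank_def)
next
  case (Suc n)
  then have "flank N (int n + 1) (int n + 1) (N + 1) (- int n)"
    using flank_left[of N "int n" "int n + 1" "N + 1"] assms by (simp add: algebra_simps)
  then show ?case using flank_right[of N "int n + 1" "int n + 1" "N + 1"] assms by (simp add: algebra_simps)
qed

text \<open>\<open>E\<close> holds the signed gaps of one row: the rotation copy yields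
  \<open>E\<close> and either reflection copy \<open>- E\<close>, so both signs occur. The
  complement \<open>N + 1 - z\<close> exchanges \<open>a\<close> and \<open>b\<close>, which
  displaces the window of reflections when they differ.\<close>

lemma flank_trails:
  assumes "flank N a b r s"
  obtains E where "trail (r, False) (s, False) (({1 - a..0} \<union> {N + 1..N + b}) \<times> {False}) ((\<lambda>d. (d, False)) ` E) (a + b)"
    "trail (r, True) (s, True) (({1 - a..0} \<union> {N + 1..N + b}) \<times> {True}) ((\<lambda>d. (- d, False)) ` E) (a + b)"
    "trail (N + 1 - s, True) (N + 1 - r, True) (({1 - b..0} \<union> {N + 1..N + a}) \<times> {True}) ((\<lambda>d. (- d, False)) ` E) (a + b)"
    "\<And>d. N + 1 \<le> d \<Longrightarrow> d \<le> N + a + b - 1 \<Longrightarrow> d \<in> E \<or> - d \<in> E"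
proof -
  obtain xs where xs: "xs \<noteq> []" "hd xs = r" "last xs = s" "int (length xs) = a + b"
    "{1 - a..0} \<union> {N + 1..N + b} \<subseteq> set xs"
    "\<forall>d\<in>{N + 1..N + a + b - 1}. d \<in> set (gaps xs) \<or> - d \<in> set (gaps xs)"
    using assms unfolding flank_def row_def by blast
  have V: "({1 - a..0} \<union> {N + 1..N + b}) \<times> {c} \<subseteq> (\<lambda>z. (0 + z, c)) ` set xs" for c :: bool
    using xs(5) by auto
  show thesis
  proof (rule that[of "set (gaps xs)"])
    show "trail (r, False) (s, False) (({1 - a..0} \<union> {N + 1..N + b}) \<times> {False}) ((\<lambda>d. (d, False)) ` set (gaps xs)) (a + b)"
      using trail_weaken[OF trail_rot[OF xs(1), of 0] V subset_refl] xs by simp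
    show "trail (r, True) (s, True) (({1 - a..0} \<union> {N + 1..N + b}) \<times> {True}) ((\<lambda>d. (- d, False)) ` set (gaps xs)) (a + b)"
      using trail_weaken[OF trail_refl[OF xs(1), of 0] V subset_refl] xs by simp
    have "({1 - b..0} \<union> {N + 1..N + a}) \<times> {True} = (\<lambda>z. (N + 1 - z, True)) ` ({1 - a..0} \<union> {N + 1..N + b})"
      unfolding image_Un image_reflect_Pair by auto
    then have "({1 - b..0} \<union> {N + 1..N + a}) \<times> {True} \<subseteq> (\<lambda>z. (N + 1 - z, True)) ` set xs"
      using xs(5) by (simp add: image_mono)
    from trail_weaken[OF trail_refl_rev[OF xs(1), of "N + 1"] this subset_refl]
    show "trail (N + 1 - s, True) (N + 1 - r, True) (({1 - b..0} \<union> {N + 1..N + a}) \<times> {True}) ((\<lambda>d. (- d, False)) ` set (gaps xs)) (a + b)"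
      using xs by simp
  qed (use xs(6) in auto)
qed

section \<open>From trails to tours\<close>

lemma residue_in_window:
  fixes z c m :: int
  assumes "m > 0"
  obtains z' where "c \<le> z'" "z' < c + m" "z' mod m = z mod m"
proof (rule that[of "c + (z - c) mod m"])
  show "(c + (z - c) mod m) mod m = z mod m" by (simp add: mod_simps)
qed (use assms in auto)

text \<open>Reduces a tour to linear arithmetic on windows of \<open>2 * N + 1\<close> integers. All
  reflections are visited, so the omitted vertex is the rotation \<open>p\<close>.\<close>

lemma trail_imp_tour:
  assumes t: "trail u v V D n" and n: "n = 4 * N + 1" and N: "N \<ge> 0"
    and V0: "\<And>z. c \<le> z \<Longrightarrow> z \<le> c + 2 * N \<Longrightarrow> z \<noteq> p \<Longrightarrow> (z, False) \<in> V"
    and V1: "\<And>z. c' \<le> z \<Longrightarrow> z \<le> c' + 2 * N \<Longrightarrow> (z, True) \<in> V"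
    and D: "\<And>d b. - N \<le> d \<Longrightarrow> d \<le> N \<Longrightarrow> (d, b) \<noteq> (0, False) \<Longrightarrow> (d, b) \<noteq> g
      \<Longrightarrow> (d, b) \<in> D \<or> (d + (2 * N + 1), b) \<in> D \<or> (d - (2 * N + 1), b) \<in> D"
  shows "tour (2 * N + 1) g"
proof -
  let ?m = "2 * N + 1"
  obtain ws where ws: "int (length ws) = 4 * N + 1" "V \<subseteq> set ws" "D \<subseteq> set (steps ws)"
    using t n unfolding trail_def by blast
  show ?thesis unfolding tour_def
  proof (intro exI conjI allI impI)
    show "int (length ws) = 2 * ?m - 1" using ws by simp
    fix w assume w: "\<not> dcong ?m w (p, False)"
    obtain z b where [simp]: "w = (z, b)" by (cases w)
    show "\<exists>w'\<in>set ws. dcong ?m w' w"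
    proof (cases b)
      case True
      obtain z' where "c' \<le> z'" "z' < c' + ?m" "z' mod ?m = z mod ?m"
        using residue_in_window[of ?m c' z] N by auto
      then show ?thesis using V1[of z'] ws(2) True by (force simp: dcong_def)
    next
      case False
      obtain z' where z': "c \<le> z'" "z' < c + ?m" "z' mod ?m = z mod ?m"
        using residue_in_window[of ?m c z] N by auto
      moreover have "z' \<noteq> p" using w z'(3) False by (auto simp: dcong_def)
      ultimately show ?thesis using V0[of z'] ws(2) False by (force simp: dcong_def)
    qed
  next
    fix d assume d: "\<not> dcong ?m d (0, False)" "\<not> dcong ?m d g"
    obtain z b where [simp]: "d = (z, b)" by (cases d)
    obtain z' where z': "- N \<le> z'" "z' < - N + ?m" "z' mod ?m = z mod ?m"
      using residue_in_window[of ?m "- N" z] N by auto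
    have "(z', b) \<noteq> (0, False)" "(z', b) \<noteq> g" using d z'(3) by (auto simp: dcong_def)
    then have "(z', b) \<in> D \<or> (z' + ?m, b) \<in> D \<or> (z' - ?m, b) \<in> D" using D z' by auto
    moreover have "dcong ?m (z', b) d" "dcong ?m (z' + ?m, b) d" "dcong ?m (z' - ?m, b) d"
      using z'(3) by (auto simp: dcong_def)
    ultimately show "\<exists>e\<in>set (steps ws). dcong ?m e d" using ws(3) by blast
  qed
qed

text \<open>Here \<open>g\<close> is the excess \<open>N - k\<close>. Lengths above \<open>N\<close>
  wrap around to those from \<open>k + 1\<close> to \<open>N\<close>; of \<open>k\<close> and
  \<open>- k\<close> the step \<open>e\<close> is present and \<open>- e\<close> may be missing, and
  negating exponents makes the sign immaterial.\<close>

lemma trail_imp_tour_rotation: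
  assumes t: "trail u v V D n" and n: "n = 4 * N + 1" and N: "1 \<le> k" "k + g = N" "g \<ge> 0"
    and V0: "\<And>z. c \<le> z \<Longrightarrow> z \<le> c + 2 * N \<Longrightarrow> z \<noteq> p \<Longrightarrow> (z, False) \<in> V"
    and V1: "\<And>z. c' \<le> z \<Longrightarrow> z \<le> c' + 2 * N \<Longrightarrow> (z, True) \<in> V"
    and D: "\<And>d. - N \<le> d \<Longrightarrow> d \<le> N \<Longrightarrow> (d, True) \<in> D \<or> (d + (2 * N + 1), True) \<in> D \<or> (d - (2 * N + 1), True) \<in> D"
    and small: "\<And>d. d \<noteq> 0 \<Longrightarrow> 1 - k \<le> d \<Longrightarrow> d \<le> k - 1 \<Longrightarrow> (d, False) \<in> D"
    and inE: "\<And>d. d \<in> E \<Longrightarrow> (d, False) \<in> D" "\<And>d. d \<in> E \<Longrightarrow> (- d, False) \<in> D"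
    and large: "\<And>d. N + 1 \<le> d \<Longrightarrow> d \<le> N + g \<Longrightarrow> d \<in> E \<or> - d \<in> E"
    and k: "(e, False) \<in> D" "\<bar>e\<bar> = k"
  shows "tour (2 * N + 1) (k, False)"
proof -
  have large': "(d, False) \<in> D" if "N + 1 \<le> \<bar>d\<bar>" "\<bar>d\<bar> \<le> N + g" for d
    using large[OF that] inE[of d] inE[of "- d"] by (auto simp: abs_if split: if_splits)
  have "tour (2 * N + 1) (- e, False)"
  proof (rule trail_imp_tour[OF t n _ V0 V1])
    fix d b assume d: "- N \<le> d" "d \<le> N" "(d, b) \<noteq> (0, False)" "(d, b) \<noteq> (- e, False)"
    show "(d, b) \<in> D \<or> (d + (2 * N + 1), b) \<in> D \<or> (d - (2 * N + 1), b) \<in> D"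
    proof (cases b)
      case True
      then show ?thesis using D d by auto
    next
      case False
      have "d \<noteq> - e" using d False by simp
      then have "\<bar>d\<bar> < k \<or> d = e \<or> k < d \<or> d < - k"
        using k(2) by (simp add: abs_if split: if_splits) linarith+
      then consider "\<bar>d\<bar> < k" | "d = e" | "k < d" | "d < - k" by blast+
      then show ?thesis
      proof cases
        case 1
        then show ?thesis using small[of d] d False by simp
      next
        case 2
        then show ?thesis using k False by simp
      next
        case 3
        then show ?thesis using large'[of "d - (2 * N + 1)"] d N False by simp
      next
        case 4
        then show ?thesis using large'[of "d + (2 * N + 1)"] d N False by simp
      qed
    qed
  qed (use N in auto)
  moreover have "tour (2 * N + 1) (- 1 * c, False)" if "tour (2 * N + 1) (c, False)" for c
    by (rule tour_scale[OF that, of _ "- 1"]) simp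
  ultimately have "tour (2 * N + 1) (e, False)" "tour (2 * N + 1) (- e, False)" by force+
  then show ?thesis using k(2) by (auto simp: abs_if split: if_splits)
qed

text \<open>\<open>h\<close> is \<open>n div 2\<close> and \<open>e\<close> witnesses the parity,
  which leaves only linear conditions on concrete ends.\<close>

lemma gvoz_endsI:
  fixes n x y h e :: int
  assumes "2 * h \<le> n" "n \<le> 2 * h + 1" "x - y - h = 2 * e" "x \<noteq> y" "0 \<le> x" "x \<le> n - 1" "0 \<le> y" "y \<le> n - 1"
    "2 * (x - y) \<le> n" "2 * (y - x) \<le> n" "n - 1 \<le> 2 * (x + y)" "2 * (x + y) \<le> 3 * n - 3"
  shows "gvoz_ends n x y"
proof -
  have "n div 2 = h" using assms(1,2) by linarith
  then have "even (x - y - n div 2)" using assms(3) by simp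
  moreover have "2 * \<bar>x - y\<bar> \<le> n" using assms(9,10) by (auto simp: abs_if)
  ultimately show ?thesis using assms unfolding gvoz_ends_def by auto
qed

section \<open>Explicit tours\<close>

text \<open>The tours missing \<open>u^k\<close> are distinguished by the excess \<open>2 l - k\<close>.  Each consists of a flanking
  row \<open>R\<close> of rotations, zigzags on \<open>{1..N}\<close> interrupted by the two graceful blocks, a copy \<open>R'\<close> of \<open>R\<close> among
  the reflections, and a last vertex reached by a step \<open>u^k\<close> or \<open>u^-k\<close>.  The zigzags skip that vertex and
  one rotation; the reflections lost at these two places and at the insertion of the blocks, together
  with \<open>N\<close> and \<open>-N\<close>, are exactly the differences at the junctions, and this determines the ends of the
  blocks.\<close>

lemma tour_excess_odd:
  fixes l b :: int
  assumes conj: gvozdjak_conjecture and b: "1 \<le> b" "3 * b \<le> l"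
  shows "tour (2 * (2 * l) + 1) (2 * l - 2 * b + 1, False)"
proof -
  let ?N = "2 * l" and ?k = "2 * l - 2 * b + 1"
  have "flank ?N b b 0 (?N + b)" using flank_from_left(2)[of ?N "nat (b - 1)"] b by simp
  from flank_trails[OF flank_rev[OF this]] obtain E where
    R: "trail (?N + b, False) (0, False)
        (({1 - b..0} \<union> {?N + 1..?N + b}) \<times> {False})
        ((\<lambda>d. (d, False)) ` E) (b + b)"
    and R': "trail (?N + 1 - 0, True) (?N + 1 - (?N + b), True)
        (({1 - b..0} \<union> {?N + 1..?N + b}) \<times> {True})
        ((\<lambda>d. (- d, False)) ` E) (b + b)"
    and E: "\<And>d. ?N + 1 \<le> d \<Longrightarrow> d \<le> ?N + b + b - 1 \<Longrightarrow> d \<in> E \<or> - d \<in> E"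
    by blast
  \<comment> \<open>\<open>x\<close> makes the step into the block the reflection
    \<open>- N\<close>; \<open>y\<close> makes the inner junction \<open>N - 6 * b + 4\<close>, lost
    at the skipped reflection vertex \<open>N - 3 * b + 2\<close>. That vertex lies \<open>k\<close>
    above the end \<open>1 - b\<close> of \<open>R'\<close>.\<close>
  have x: "gvoz_ends ?k (l - b) (2 * b - 2)"
    by (rule gvoz_endsI[where h = "l - b" and e = "1 - b"]) (use b in auto)
  note A = block_rot_refl_rev[OF conj x, of "?N + b + 1" "?N + b + 1"]
  note Wa = zigzag_qp[of ?N "?N - 3 * b + 3" "3 * b - 2" 1]
  note Wb = zigzag_qq[of "?N - 3 * b + 1" "l + 1" "l - 2" "3 * b - 1"]
  note Wc = zigzag_pp[of l 1 "?N - 1" "l - 1"]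
  note t = trail_append[OF trail_append[OF trail_append[OF trail_append[OF trail_append[OF trail_append[OF
    R Wa] Wb] A] Wc] R'] trail_single[of "(?N - 3 * b + 2, True)"]]
  show ?thesis
  proof (rule trail_imp_tour_rotation[where N = ?N and k = ?k and g = "2 * b - 1" and c = "1 - b" and c' = "1 - b"
        and p = ?N and E = E and e = "- ?k", OF t])
    show "d \<in> E \<or> - d \<in> E" if "?N + 1 \<le> d" "d \<le> ?N + (2 * b - 1)" for d using E that by simp
  qed (use b in \<open>simp_all add: dif_def image_iff\<close>, (smt (verit))+)
qed

text \<open>Here \<open>u^k\<close> has order 3, so automorphisms take it only to itself or its
  inverse. The second zigzag of the previous tour has no room and becomes the vertex
  \<open>(l, True)\<close>; the block ends are swapped.\<close>

lemma tour_third_of_order: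
  fixes l b :: int
  assumes conj: gvozdjak_conjecture and b: "1 \<le> b" "l = 3 * b - 1"
  shows "tour (2 * (2 * l) + 1) (2 * l - 2 * b + 1, False)"
proof -
  let ?N = "2 * l" and ?k = "2 * l - 2 * b + 1"
  have "flank ?N b b 0 (?N + b)" using flank_from_left(2)[of ?N "nat (b - 1)"] b by simp
  then have "flank ?N b b (?N + b) 0" by (rule flank_rev)
  from flank_trails[OF this] obtain E where
    R: "trail (?N + b, False) (0, False)
        (({1 - b..0} \<union> {?N + 1..?N + b}) \<times> {False})
        ((\<lambda>d. (d, False)) ` E) (b + b)"
    and R': "trail (?N + 1 - 0, True) (?N + 1 - (?N + b), True)
        (({1 - b..0} \<union> {?N + 1..?N + b}) \<times> {True})
        ((\<lambda>d. (- d, False)) ` E) (b + b)"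
    and E: "\<And>d. ?N + 1 \<le> d \<Longrightarrow> d \<le> ?N + b + b - 1 \<Longrightarrow> d \<in> E \<or> - d \<in> E"
    by blast
  have x: "gvoz_ends ?k (2 * b - 2) (2 * b - 1)"
    by (rule gvoz_endsI[where h = "l - b" and e = "- b"]) (use b in auto)
  note Wa = zigzag_qp[of ?N "l + 2" "l - 1" 1]
  note Wb = trail_single[of "(l, True)"]
  note A = block_rot_refl_rev[OF conj x, of "?N + b + 1" "?N + b + 1"]
  note Wc = zigzag_pp[of "l - 1" 1 "?N - 1" l]
  note t = trail_append[OF trail_append[OF trail_append[OF trail_append[OF trail_append[OF trail_append[OF R
    Wa]
    Wb]
    A]
    Wc]
    R']
    trail_single[of "(l + 1, True)"]]
  show ?thesis
  proof (rule trail_imp_tour_rotation[where N = ?N and k = ?k and g = "2 * b - 1" and c = "1 - b" and c' = "1 - b"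
        and p = "?N" and E = E and e = "- ?k", OF t])
    show "d \<in> E \<or> - d \<in> E" if "?N + 1 \<le> d" "d \<le> ?N + (2 * b - 1)" for d using E that by simp
  qed (use b in \<open>simp_all add: dif_def image_iff\<close>, (smt (verit))+)
qed

lemma tour_excess_0_mod_4:
  fixes l c :: int
  assumes conj: gvozdjak_conjecture and b: "1 \<le> c" "6 * c + 1 \<le> l"
  shows "tour (2 * (2 * l) + 1) (2 * l - 4 * c, False)"
proof -
  let ?N = "2 * l" and ?k = "2 * l - 4 * c"
  have "flank ?N (2 * c) (2 * c + 1) (?N + 1) (?N + 2 * c + 1)"
    using flank_from_right[of ?N "nat (2 * c)"] b by simp
  then have "flank ?N (2 * c) (2 * c + 1) (?N + 2 * c + 1) (?N + 1)" by (rule flank_rev)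
  from flank_trails[OF this] obtain E where
    R: "trail (?N + 2 * c + 1, False) (?N + 1, False)
        (({1 - (2 * c)..0} \<union> {?N + 1..?N + (2 * c + 1)}) \<times> {False})
        ((\<lambda>d. (d, False)) ` E) (2 * c + (2 * c + 1))"
    and R': "trail (?N + 2 * c + 1, True) (?N + 1, True)
        (({1 - (2 * c)..0} \<union> {?N + 1..?N + (2 * c + 1)}) \<times> {True})
        ((\<lambda>d. (- d, False)) ` E) (2 * c + (2 * c + 1))"
    and E: "\<And>d. ?N + 1 \<le> d \<Longrightarrow> d \<le> ?N + 2 * c + (2 * c + 1) - 1 \<Longrightarrow> d \<in> E \<or> - d \<in> E"
    by blast
  \<comment> \<open>The step into the block is \<open>- N\<close> modulo the order, and
    \<open>y\<close> supplies \<open>8 * c + 1 - N\<close>, lost at the skipped vertex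
    \<open>4 * c + 1\<close>. As \<open>x\<close> is half the block length, the parity condition
    asks that \<open>y\<close>, half the excess, be even.\<close>
  have x: "gvoz_ends ?k (l - 2 * c) (2 * c)"
    by (rule gvoz_endsI[where h = "l - 2 * c" and e = "- c"]) (use b in auto)
  note Wa = zigzag_qq[of ?N "l + c + 1" "l - c - 1" 1]
  note Wb = zigzag_pp[of "l + c" "l + 1" "l + 1" "l - c + 1"]
  note A = block_refl_rot_rev[OF conj x, of "?N + 2 * c + 2" "?N + 2 * c + 2"]
  note Wc = zigzag_qp[of l "4 * c + 2" "?N - 4 * c" "l + 2"]
  note Wd = zigzag_qp[of "4 * c" 1 ?N "?N - 4 * c + 1"]
  note t = trail_append[OF trail_append[OF trail_append[OF trail_append[OF trail_append[OF trail_append[OF trail_append[OF R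
    Wa]
    Wb]
    A]
    Wc]
    Wd]
    R']
    trail_single[of "(4 * c + 1, True)"]]
  show ?thesis
  proof (rule trail_imp_tour_rotation[where N = ?N and k = ?k and g = "4 * c" and c = "1 - 2 * c" and c' = "1 - 2 * c"
        and p = "l - c" and E = E and e = "?k", OF t])
    show "d \<in> E \<or> - d \<in> E" if "?N + 1 \<le> d" "d \<le> ?N + (4 * c)" for d using E that by simp
  qed (use b in \<open>simp_all add: dif_def image_iff\<close>, (smt (verit))+)
qed

text \<open>The case \<open>c = 0\<close> of the previous tour: the flank is a single vertex, and
  the last zigzag would be empty, which \<open>zigzag\<close> excludes.\<close>

lemma tour_excess_zero:
  fixes l :: int
  assumes conj: gvozdjak_conjecture and b: "2 \<le> l"
  shows "tour (2 * (2 * l) + 1) (2 * l, False)"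
proof -
  let ?N = "2 * l" and ?k = "2 * l"
  have "flank ?N 0 1 (?N + 1) (?N + 1)"
    using flank_from_right[of ?N 0] b by simp
  from flank_trails[OF this] obtain E where
    R: "trail (?N + 1, False) (?N + 1, False)
        (({1 - 0..0} \<union> {?N + 1..?N + 1}) \<times> {False})
        ((\<lambda>d. (d, False)) ` E) (0 + 1)"
    and R': "trail (?N + 1, True) (?N + 1, True)
        (({1 - 0..0} \<union> {?N + 1..?N + 1}) \<times> {True})
        ((\<lambda>d. (- d, False)) ` E) (0 + 1)"
    and E: "\<And>d. ?N + 1 \<le> d \<Longrightarrow> d \<le> ?N + 0 + 1 - 1 \<Longrightarrow> d \<in> E \<or> - d \<in> E"
    by blast
  have x: "gvoz_ends ?k l 0"
    by (rule gvoz_endsI[where h = "l" and e = "0"]) (use b in auto)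
  note Wa = zigzag_qq[of ?N "l + 1" "l - 1" 1]
  note Wb = trail_single[of "(l + 1, False)"]
  note A = block_refl_rot_rev[OF conj x, of "?N + 2" "?N + 2"]
  note Wc = zigzag_qp[of l 2 ?N "l + 2"]
  note t = trail_append[OF trail_append[OF trail_append[OF trail_append[OF trail_append[OF trail_append[OF R
    Wa]
    Wb]
    A]
    Wc]
    R']
    trail_single[of "(1, True)"]]
  show ?thesis
  proof (rule trail_imp_tour_rotation[where N = ?N and k = ?k and g = "0" and c = "1" and c' = "1"
        and p = "l" and E = E and e = "?k", OF t])
    show "d \<in> E \<or> - d \<in> E" if "?N + 1 \<le> d" "d \<le> ?N + 0" for d using E that by simp
  qed (use b in \<open>simp_all add: dif_def image_iff\<close>, (smt (verit))+)
qed

text \<open>Moving the ends of the flank by \<open>2 * i\<close> makes its junctions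
  \<open>2 * \<rho> - N\<close> and \<open>2 * \<rho> + 2\<close>, lost at the skipped rotation
  \<open>N - \<rho>\<close> and where the block is inserted. The parity condition asks for
  \<open>\<rho>\<close> odd, so \<open>i\<close> follows the parity of \<open>c\<close>.\<close>

lemma tour_excess_2_mod_4:
  fixes l c i h \<rho> :: int
  assumes conj: gvozdjak_conjecture and b: "1 \<le> \<rho>" "c = \<rho> + i" "\<rho> = 2 * h + 1" "0 \<le> i" "i \<le> 1" "6 * c + 4 \<le> l"
    and f: "flank (2 * l) (2 * c + 2) (2 * c + 1) (- (2 * i)) (- (2 * c + 1 - 2 * i))"
  shows "tour (2 * (2 * l) + 1) (2 * l - 4 * c - 2, False)"
proof -
  let ?N = "2 * l" and ?k = "2 * l - 4 * c - 2"
  from flank_trails[OF f] obtain E where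
    R: "trail (- (2 * i), False) (- (2 * c + 1 - 2 * i), False)
        (({1 - (2 * c + 2)..0} \<union> {?N + 1..?N + (2 * c + 1)}) \<times> {False})
        ((\<lambda>d. (d, False)) ` E) (2 * c + 2 + (2 * c + 1))"
    and R': "trail (?N + 1 - (- (2 * c + 1 - 2 * i)), True) (?N + 1 - (- (2 * i)), True)
        (({1 - (2 * c + 1)..0} \<union> {?N + 1..?N + (2 * c + 2)}) \<times> {True})
        ((\<lambda>d. (- d, False)) ` E) (2 * c + 2 + (2 * c + 1))"
    and E: "\<And>d. ?N + 1 \<le> d \<Longrightarrow> d \<le> ?N + (2 * c + 2) + (2 * c + 1) - 1 \<Longrightarrow> d \<in> E \<or> - d \<in> E"
    by blast
  have x: "gvoz_ends ?k (l - \<rho> - 2 * c - 3) (2 * c + 1 + 2 * i)"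
    by (rule gvoz_endsI[where h = "l - 2 * c - 1" and e = "- h - c - i - 2"]) (use b in auto)
  note Wa = zigzag_qp[of ?N "l + \<rho> + 2" "l - \<rho> - 1" 1]
  note A = block_refl_rot_rev[OF conj x, of "?N + 2 * c + 3" "?N + 2 * c + 2"]
  note Wb = zigzag_qp[of "l + \<rho> + 1" "4 * c + 4 + 2 * i" "?N - 4 * c - 3 - 2 * i" "l - \<rho>"]
  note Wc = zigzag_qq[of "4 * c + 2 + 2 * i" \<rho> "?N - \<rho> - 1" "?N - 4 * c - 2 - 2 * i"]
  note Wd = zigzag_pp[of "\<rho> - 1" 1 ?N "?N - \<rho> + 1"]
  note t = trail_append[OF trail_append[OF trail_append[OF trail_append[OF trail_append[OF trail_append[OF trail_append[OF R
    Wa]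
    A]
    Wb]
    Wc]
    Wd]
    R']
    trail_single[of "(4 * c + 3 + 2 * i, True)"]]
  show ?thesis
  proof (rule trail_imp_tour_rotation[where N = ?N and k = ?k and g = "4 * c + 2" and c = "- 2 * c - 1" and c' = "- 2 * c"
        and p = "?N - \<rho>" and E = E and e = "?k", OF t])
    show "d \<in> E \<or> - d \<in> E" if "?N + 1 \<le> d" "d \<le> ?N + (4 * c + 2)" for d using E that by simp
  qed (use b in \<open>simp_all add: dif_def image_iff\<close>, (smt (verit))+)
qed

lemma tour_excess_two_odd:
  fixes l h :: int
  assumes conj: gvozdjak_conjecture and b: "7 \<le> l" "l = 2 * h + 1"
  shows "tour (2 * (2 * l) + 1) (2 * l - 2, False)"
proof -
  let ?N = "2 * l" and ?k = "2 * l - 2"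
  have "flank ?N 2 1 0 (- 1)" using flank_from_left(1)[of ?N 1] b by simp
  from flank_trails[OF this] obtain E where
    R: "trail (0, False) (- 1, False)
        (({1 - 2..0} \<union> {?N + 1..?N + 1}) \<times> {False})
        ((\<lambda>d. (d, False)) ` E) (2 + 1)"
    and R': "trail (?N + 1 - (- 1), True) (?N + 1 - 0, True)
        (({1 - 1..0} \<union> {?N + 1..?N + 2}) \<times> {True})
        ((\<lambda>d. (- d, False)) ` E) (2 + 1)"
    and E: "\<And>d. ?N + 1 \<le> d \<Longrightarrow> d \<le> ?N + 2 + 1 - 1 \<Longrightarrow> d \<in> E \<or> - d \<in> E"
    by blast
  \<comment> \<open>\<open>x - y = 2\<close> makes the inner junction \<open>- 1\<close>, lost at
    the skipped rotation \<open>l + 1\<close>; an even difference is right because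
    \<open>l - 1\<close> is even.\<close>
  have x: "gvoz_ends ?k (l + 2) l"
    by (rule gvoz_endsI[where h = "l - 1" and e = "1 - h"]) (use b in auto)
  note Wa = zigzag_qp[of ?N "l + 2" "l - 1" 1]
  note A = block_refl_rot[OF conj x, of "?N + 3" "?N + 2"]
  note Wb = zigzag_qq[of "l + 1" l l l]
  note Wc = zigzag_pp[of "l - 1" 4 "?N - 2" "l + 2"]
  note Wd = zigzag_qp[of 2 1 ?N "?N - 1"]
  note t = trail_append[OF trail_append[OF trail_append[OF trail_append[OF trail_append[OF trail_append[OF trail_append[OF R
    Wa]
    A]
    Wb]
    Wc]
    Wd]
    R']
    trail_single[of "(3, True)"]]
  show ?thesis
  proof (rule trail_imp_tour_rotation[where N = ?N and k = ?k and g = "2" and c = "- 1" and c' = "0"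
        and p = "l + 1" and E = E and e = "?k", OF t])
    show "d \<in> E \<or> - d \<in> E" if "?N + 1 \<le> d" "d \<le> ?N + (2)" for d using E that by simp
  qed (use b in \<open>simp_all add: dif_def image_iff\<close>, (smt (verit))+)
qed

lemma tour_excess_two_even:
  fixes l h :: int
  assumes conj: gvozdjak_conjecture and b: "6 \<le> l" "l = 2 * h"
  shows "tour (2 * (2 * l) + 1) (2 * l - 2, False)"
proof -
  let ?N = "2 * l" and ?k = "2 * l - 2"
  have "flank ?N 1 2 (?N + 1) (?N + 2)" using flank_from_right[of ?N 1] b by (simp add: algebra_simps)
  from flank_trails[OF this] obtain E where
    R: "trail (?N + 1, False) (?N + 2, False)
        (({1 - 1..0} \<union> {?N + 1..?N + 2}) \<times> {False})
        ((\<lambda>d. (d, False)) ` E) (1 + 2)"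
    and R': "trail (?N + 1 - (?N + 2), True) (?N + 1 - (?N + 1), True)
        (({1 - 2..0} \<union> {?N + 1..?N + 1}) \<times> {True})
        ((\<lambda>d. (- d, False)) ` E) (1 + 2)"
    and E: "\<And>d. ?N + 1 \<le> d \<Longrightarrow> d \<le> ?N + 1 + 2 - 1 \<Longrightarrow> d \<in> E \<or> - d \<in> E"
    by blast
  \<comment> \<open>Now \<open>l - 1\<close> is odd, so the ends may differ by one; the inner
    junction is the reflection 0, lost at the skipped rotation \<open>l\<close>.\<close>
  have x: "gvoz_ends ?k l (l + 1)"
    by (rule gvoz_endsI[where h = "l - 1" and e = "- h"]) (use b in auto)
  note Wa = zigzag_qp[of ?N "?N - 1" 2 1]
  note Wb = zigzag_qq[of "?N - 3" l "l - 1" 3]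
  note Wc = trail_single[of "(l + 1, False)"]
  note A = block_refl_rot[OF conj x, of "?N + 2" "?N + 3"]
  note Wd = zigzag_qp[of "l - 1" 1 ?N "l + 2"]
  note t = trail_append[OF trail_append[OF trail_append[OF trail_append[OF trail_append[OF trail_append[OF trail_append[OF R
    Wa]
    Wb]
    Wc]
    A]
    Wd]
    R']
    trail_single[of "(?N - 2, True)"]]
  show ?thesis
  proof (rule trail_imp_tour_rotation[where N = ?N and k = ?k and g = "2" and c = "0" and c' = "- 1"
        and p = "l" and E = E and e = "- ?k", OF t])
    show "d \<in> E \<or> - d \<in> E" if "?N + 1 \<le> d" "d \<le> ?N + (2)" for d using E that by simp
  qed (use b in \<open>simp_all add: dif_def image_iff\<close>, (smt (verit))+)
qed


section \<open>Tours missing a reflection\<close>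

text \<open>The zigzags and outer junctions miss the reflections 1 and \<open>1 - N\<close>, and the
  block's inner junction \<open>x - y = 1\<close> supplies the first. For even \<open>l\<close>
  parity forbids this, so there the zigzags are cut to leave 2 instead.\<close>

lemma tour_reflection_odd:
  fixes l h :: int
  assumes conj: gvozdjak_conjecture and b: "1 \<le> l" "l = 2 * h + 1"
  shows "tour (2 * (2 * l) + 1) (1 - 2 * l, True)"
proof -
  let ?N = "2 * l"
  have x: "gvoz_ends (?N + 1) l (l - 1)"
    by (rule gvoz_endsI[where h = l and e = "- h"]) (use b in auto)
  note Wa = zigzag_qq[of ?N "l + 1" "l - 1" 1]
  note A = block_rot_refl[OF conj x, of "?N + 1" "?N + 1"]
  note Wb = zigzag_pq[of l 1 "?N - 1" l]
  note t = trail_append[OF trail_append[OF Wa A] Wb]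
  show ?thesis
    by (rule trail_imp_tour[where N = ?N and c = 1 and c' = 1 and p = ?N, OF t])
      (use b in \<open>simp_all add: dif_def image_iff\<close>, (smt (verit))+)
qed

lemma tour_reflection_even:
  fixes l h :: int
  assumes conj: gvozdjak_conjecture and b: "2 \<le> l" "l = 2 * h"
  shows "tour (2 * (2 * l) + 1) (1 - 2 * l, True)"
proof -
  let ?N = "2 * l"
  have x: "gvoz_ends (?N + 1) (l - 1) (l + 1)"
    by (rule gvoz_endsI[where h = l and e = "- 1 - h"]) (use b in auto)
  note Wa = zigzag_qp[of ?N "l + 2" "l - 1" 1]
  note A = block_refl_rot[OF conj x, of "?N + 1" "?N + 1"]
  note Wb = zigzag_qq[of "l + 1" 1 "?N - 1" l]
  note t = trail_append[OF trail_append[OF Wa A] Wb]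
  show ?thesis
    by (rule trail_imp_tour[where N = ?N and c = 1 and c' = 1 and p = ?N, OF t])
      (use b in \<open>simp_all add: dif_def image_iff\<close>, (smt (verit))+)
qed

section \<open>Twisted flanking rows and the smallest case\<close>

lemma flankI:
  assumes "xs \<noteq> []" "int (length xs) = a + b" "hd xs = r" "last xs = s"
    and "\<And>z. 1 - a \<le> z \<Longrightarrow> z \<le> 0 \<Longrightarrow> z \<in> set xs" "\<And>z. 1 \<le> z \<Longrightarrow> z \<le> b \<Longrightarrow> N + z \<in> set xs"
    and "\<And>d. 1 \<le> d \<Longrightarrow> d \<le> a + b - 1 \<Longrightarrow> N + d \<in> set (gaps xs) \<or> - (N + d) \<in> set (gaps xs)"
  shows "flank N a b r s"
proof -
  have "{1 - a..0} \<union> {N + 1..N + b} \<subseteq> set xs"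
  proof
    fix z assume "z \<in> {1 - a..0} \<union> {N + 1..N + b}"
    then show "z \<in> set xs" using assms(5)[of z] assms(6)[of "z - N"] by auto
  qed
  moreover have "d \<in> set (gaps xs) \<or> - d \<in> set (gaps xs)" if "d \<in> {N + 1..N + a + b - 1}" for d
    using assms(7)[of "d - N"] that by auto
  ultimately show ?thesis unfolding flank_def row_def using assms(1-4) by blast
qed

text \<open>The zigzag row \<open>flank_from_left\<close> would lead to block ends violating the parity condition for
  excess \<open>2\<close> modulo \<open>8\<close>; the following rows end two positions further in.\<close>

lemma flank_twisted_step:
  assumes "flank N (b + 1) b (- 2) (2 - b)" "0 \<le> N" "2 \<le> b"
  shows "flank N (b + 3 + 1) (b + 3) (- 2) (2 - (b + 3))"
proof -
  \<comment> \<open>The six appended vertices give the lengths \<open>N + 2 * b + 1\<close>, then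
    \<open>N + 2 * b + 6\<close> down to \<open>N + 2 * b + 2\<close>: exactly the next six.\<close>
  have "row (- 2) (2 - (b + 3)) ({1 - (b + 3 + 1)..0} \<union> {N + 1..N + (b + 3)})
    {N + 1..N + (b + 3 + 1) + (b + 3) - 1} (b + 1 + b + 1 + 1 + 1 + 1 + 1 + 1)"
    by (rule row_weaken[OF row_snoc[OF row_snoc[OF row_snoc[OF row_snoc[OF row_snoc[OF row_snoc[OF
      assms(1)[unfolded flank_def], of "N + b + 3"], of "- b - 3"], of "N + b + 2"], of "- b - 2"],
      of "N + b + 1"], of "2 - (b + 3)"]]) (use assms(2,3) in auto)
  then show ?thesis by (simp add: flank_def algebra_simps)
qed

lemma flank_twisted:
  assumes N: "0 \<le> N" and b: "b \<ge> 2" "b \<noteq> 4"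
  shows "flank N (int b + 1) (int b) (- 2) (2 - int b)"
  using b
proof (induction b rule: less_induct)
  case (less b)
  have "flank N 3 2 (- 2) 0"
    by (rule flankI[of "[- 2, N + 2, - 1, N + 1, 0]"]) (use N in \<open>simp_all\<close>, (smt (verit))+)
  moreover have "flank N 4 3 (- 2) (- 1)"
    by (rule flankI[of "[- 2, N + 2, - 3, N + 3, 0, N + 1, - 1]"]) (use N in \<open>simp_all\<close>, (smt (verit))+)
  moreover have "flank N 8 7 (- 2) (- 5)"
    by (rule flankI[of "[- 2, N + 6, - 6, N + 7, - 7, N + 4, - 3, N + 3, - 1, N + 2, 0, N + 1, - 4, N + 5, - 5]"])
      (use N in \<open>simp_all\<close>, (smt (verit))+)
  \<comment> \<open>Induction in steps of three; 7 is a third base case because 4 is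
    excluded.\<close>
  moreover have "b = 2 \<or> b = 3 \<or> b = 7 \<or> (b - 3 \<ge> 2 \<and> b - 3 \<noteq> 4 \<and> b - 3 < b)" using less.prems by arith
  ultimately show ?case
    using less.IH[of "b - 3"] flank_twisted_step[of N "int (b - 3)"] N by (auto simp: algebra_simps of_nat_diff)
qed

text \<open>The case \<open>l = 1\<close>, too small for the tour of excess 0; 2 is then the only
  exponent in the range of \<open>tour_rotation_large\<close>.\<close>

lemma tour_five: "tour 5 (2, False)"
proof -
  let ?ws = "[(0, False), (0, True), (1, False), (2, False), (3, True), (4, True), (1, True), (4, False), (2, True)] :: (int \<times> bool) list"
  have t: "trail (0, False) (2, True) (set ?ws) (set (steps ?ws)) 9"
    unfolding trail_def by (rule exI[of _ ?ws]) simp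
  have "tour (2 * 2 + 1) (2, False)"
    by (rule trail_imp_tour[where c = 0 and c' = 0 and p = 3, OF t])
      (simp_all add: dif_def, (smt (verit))+)
  then show ?thesis by simp
qed

section \<open>All rotations by scaling exponents\<close>

lemma tour_uminus: "tour m (c, False) \<Longrightarrow> tour m (- c, False)"
  using tour_scale[of m c "- 1" "- 1"] by simp

lemma tour_rotation_large:
  fixes l k :: int
  assumes conj: gvozdjak_conjecture and l: "1 \<le> l" and k: "4 * l + 1 \<le> 3 * k" "k \<le> 2 * l"
  shows "tour (4 * l + 1) (k, False)"
proof -
  define g where "g = 2 * l - k"
  consider b where "g = 2 * b - 1" "1 \<le> b" | "g = 0" | c where "g = 4 * c" "1 \<le> c"
    | c where "g = 4 * c + 2" "1 \<le> c" | "g = 2"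
  proof -
    have "g \<ge> 0" using k g_def by simp
    then have "(\<exists>b. g = 2 * b - 1 \<and> 1 \<le> b) \<or> g = 0 \<or> (\<exists>c. g = 4 * c \<and> 1 \<le> c) \<or> (\<exists>c. g = 4 * c + 2 \<and> 1 \<le> c) \<or> g = 2"
      by presburger
    then show thesis using that by blast
  qed
  then show ?thesis
  proof cases
    case (1 b)
    then have k': "k = 2 * l - 2 * b + 1" "3 * b - 1 \<le> l" using g_def k by auto
    show ?thesis
    proof (cases "3 * b \<le> l")
      case True
      then show ?thesis using tour_excess_odd[OF conj 1(2)] k' by simp
    next
      case False
      then show ?thesis using tour_third_of_order[OF conj 1(2), of l] k' by simp
    qed
  next
    case 2
    then have k': "k = 2 * l" using g_def by simp
    show ?thesis
    proof (cases "l = 1")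
      case True
      then show ?thesis using tour_five k' by simp
    next
      case False
      then show ?thesis using tour_excess_zero[OF conj, of l] k' l by simp
    qed
  next
    case (3 c)
    then have "k = 2 * l - 4 * c" "6 * c + 1 \<le> l" using g_def k by auto
    then show ?thesis using tour_excess_0_mod_4[OF conj 3(2), of l] by simp
  next
    case (4 c)
    then have k': "k = 2 * l - 4 * c - 2" "6 * c + 4 \<le> l" using g_def k by auto
    \<comment> \<open>The parity of \<open>c\<close> decides between the plain and the twisted
      flank, so that \<open>\<rho>\<close> is odd.\<close>
    show ?thesis
    proof (cases "even c")
      case True
      then obtain h where h: "c = 2 * h + 2" "0 \<le> h" using 4(2)
      proof -
        obtain h where "c = 2 * h" using True by blast
        then show thesis using that[of "h - 1"] 4(2) by simp
      qed
      have "flank (2 * l) (2 * c + 2) (2 * c + 1) (- 2) (2 - (2 * c + 1))"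
        using flank_twisted[of "2 * l" "nat (2 * c + 1)"] 4(2) l h by (simp add: algebra_simps)
      then have "tour (2 * (2 * l) + 1) (2 * l - 4 * c - 2, False)"
        using tour_excess_2_mod_4[OF conj, of "2 * h + 1" c 1 h l] h k'(2) by simp
      then show ?thesis using k'(1) by simp
    next
      case False
      then obtain h where h: "c = 2 * h + 1" by (elim oddE)
      have "flank (2 * l) (2 * c + 2) (2 * c + 1) 0 (- (2 * c + 1))"
        using flank_from_left(1)[of "2 * l" "nat (2 * c + 1)"] 4(2) l by (simp add: add.commute)
      then show ?thesis using tour_excess_2_mod_4[OF conj, of c c 0 h l] h k' 4(2) by simp
    qed
  next
    case 5
    then have k': "k = 2 * l - 2" "4 \<le> l" using g_def k by auto
    \<comment> \<open>The explicit tours begin at \<open>l = 6\<close> and \<open>l = 7\<close>; the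
      two smaller values are reached by scaling a tour for another exponent.\<close>
    consider "l = 4" | "l = 5" | h where "6 \<le> l" "l = 2 * h" | h where "7 \<le> l" "l = 2 * h + 1"
    proof -
      have "l = 4 \<or> l = 5 \<or> (\<exists>h. 6 \<le> l \<and> l = 2 * h) \<or> (\<exists>h. 7 \<le> l \<and> l = 2 * h + 1)"
        using k'(2) by presburger
      then show thesis using that by blast
    qed
    then show ?thesis
    proof cases
      case 1
      \<comment> \<open>\<open>4 * 6\<close> is \<open>7\<close> modulo \<open>17\<close>, and below \<open>4 * 8\<close> is \<open>- 10\<close> modulo \<open>21\<close>\<close>
      have "tour 17 (7, False)" using tour_excess_odd[OF conj, of 1 4] by simp
      then have "tour 17 (13 * 7, False)" by (rule tour_scale[of _ _ _ 4]) simp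
      then show ?thesis using tour_dcong[of 17 "(13 * 7, False)" "(6, False)"] 1 k' by (simp add: dcong_def)
    next
      case 2
      have "tour 21 (10, False)" using tour_excess_zero[OF conj, of 5] by simp
      then have "tour 21 (5 * 10, False)" by (rule tour_scale[of _ _ _ "- 4"]) simp
      then show ?thesis using tour_dcong[of 21 "(5 * 10, False)" "(8, False)"] 2 k' by (simp add: dcong_def)
    next
      case (3 h)
      then show ?thesis using tour_excess_two_even[OF conj, of l h] k' by simp
    next
      case (4 h)
      then show ?thesis using tour_excess_two_odd[OF conj, of l h] k' by simp
    qed
  qed
qed

lemma tour_half:
  assumes "tour (4 * l + 1) (2 * k, False)"
  shows "tour (4 * l + 1) (k, False)"
proof -
  have "(2 * l + 1) * 2 mod (4 * l + 1) = 1 mod (4 * l + 1)"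
    by (simp add: mod_eq_dvd_iff add.commute)
  then have "tour (4 * l + 1) ((2 * l + 1) * (2 * k), False)" using tour_scale[OF assms] by blast
  then show ?thesis
  proof (rule tour_dcong)
    have "(2 * l + 1) * (2 * k) - k = (4 * l + 1) * k" by (simp add: algebra_simps)
    then show "dcong (4 * l + 1) ((2 * l + 1) * (2 * k), False) (k, False)"
      unfolding dcong_def by (simp add: mod_eq_dvd_iff)
  qed
qed

text \<open>While \<open>3 * k < 4 * l + 1\<close>, pass to \<open>2 * k\<close>, or to
  \<open>4 * l + 1 - 2 * k\<close> once \<open>2 * k\<close> exceeds \<open>2 * l\<close>. Either is
  larger than \<open>k\<close>, so \<open>tour_rotation_large\<close> applies in the end.\<close>

lemma tour_rotation:
  fixes l k :: int
  assumes conj: gvozdjak_conjecture and l: "1 \<le> l" and k: "1 \<le> k" "k \<le> 2 * l"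
  shows "tour (4 * l + 1) (k, False)"
  using k
proof (induction "nat (2 * l - k)" arbitrary: k rule: less_induct)
  case less
  show ?case
  proof (cases "4 * l + 1 \<le> 3 * k")
    case True
    then show ?thesis using tour_rotation_large conj l less.prems by blast
  next
    case False
    have "tour (4 * l + 1) (2 * k, False)"
    proof (cases "2 * k \<le> 2 * l")
      case True
      then show ?thesis using less.hyps[of "2 * k"] less.prems by simp
    next
      case False
      then have "tour (4 * l + 1) (4 * l + 1 - 2 * k, False)"
        using less.hyps[of "4 * l + 1 - 2 * k"] less.prems \<open>\<not> 4 * l + 1 \<le> 3 * k\<close> by simp
      then have "tour (4 * l + 1) (- (4 * l + 1 - 2 * k), False)" by (rule tour_uminus)
      then show ?thesis by (rule tour_dcong) (simp add: dcong_def mod_eq_dvd_iff)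
    qed
    then show ?thesis by (rule tour_half)
  qed
qed

lemma tour_reflection:
  assumes "gvozdjak_conjecture" "1 \<le> l"
  shows "tour (4 * l + 1) (r, True)"
proof -
  have "tour (4 * l + 1) (1 - 2 * l, True)"
  proof (cases "even l")
    case True
    then obtain h where "l = 2 * h" by blast
    then show ?thesis using tour_reflection_even[OF assms(1), of l h] assms(2) by simp
  next
    case False
    then obtain h where "l = 2 * h + 1" by (elim oddE)
    then show ?thesis using tour_reflection_odd[OF assms(1), of l h] assms(2) by simp
  qed
  from tour_shift[OF this, of "r - (1 - 2 * l)"] show ?thesis by simp
qed

theorem theorem5p3:
  assumes "gvozdjak_conjecture"
  shows "\<forall>l::nat. \<forall>S. l \<ge> 1 \<and> S \<subseteq> carrier (dihedral_group (4 * l + 1)) - {\<one>\<^bsub>dihedral_group (4 * l + 1)\<^esub>}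
            \<and> card S = 8 * l \<longrightarrow> has_S_sequencing (dihedral_group (4 * l + 1)) S"
proof (intro allI impI, elim conjE)
  fix l :: nat and S
  let ?m = "4 * l + 1"
  let ?G = "dihedral_group ?m"
  assume l: "1 \<le> l" and S: "S \<subseteq> carrier ?G - {\<one>\<^bsub>?G\<^esub>}" and card: "card S = 8 * l"
  have "\<one>\<^bsub>?G\<^esub> \<in> carrier ?G" by (simp add: one_dihedral carrier_dihedral)
  then have "card (carrier ?G - {\<one>\<^bsub>?G\<^esub>}) = 8 * l + 1"
    by (simp add: card_carrier_dihedral)
  moreover have "finite (carrier ?G - {\<one>\<^bsub>?G\<^esub>})" by (simp add: finite_carrier_dihedral)
  ultimately have "card (carrier ?G - {\<one>\<^bsub>?G\<^esub>} - S) = 1"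
    using S card by (simp add: card_Diff_subset finite_subset)
  then obtain g where g: "carrier ?G - {\<one>\<^bsub>?G\<^esub>} - S = {g}" by (auto simp: card_1_singleton_iff)
  have S_eq: "S = carrier ?G - {\<one>\<^bsub>?G\<^esub>, g}" using g S by blast
  obtain i a where ia: "g = (i, a)" by (cases g)
  have gC: "g \<in> carrier ?G" "g \<noteq> \<one>\<^bsub>?G\<^esub>" using g by blast+
  have m: "int ?m = 4 * int l + 1" by simp
  have "tour (4 * int l + 1) (int i, a)"
  proof (cases a)
    case True
    then show ?thesis using tour_reflection[OF assms] l by simp
  next
    case False
    then have i: "1 \<le> i" "i < ?m" using gC ia by (auto simp: one_dihedral carrier_dihedral)
    show ?thesis
    proof (cases "i \<le> 2 * l")
      case True
      then show ?thesis using tour_rotation[OF assms, of "int l" "int i"] l i False by simp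
    next
      case False
      \<comment> \<open>An exponent beyond half the order is negated into the range of
        \<open>tour_rotation\<close>.\<close>
      then have "tour (4 * int l + 1) (4 * int l + 1 - int i, False)"
        using tour_rotation[OF assms, of "int l" "4 * int l + 1 - int i"] l i by simp
      then have "tour (4 * int l + 1) (- (4 * int l + 1 - int i), False)" by (rule tour_uminus)
      then show ?thesis
        by (rule tour_dcong) (use \<open>\<not> a\<close> in \<open>simp add: dcong_def mod_eq_dvd_iff\<close>)
    qed
  qed
  then show "has_S_sequencing ?G S"
    using tour_imp_has_S_sequencing[of ?m g] gC ia unfolding S_eq m by simp
qed

end
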